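(* For Lebesgue-almost all real $\theta>1$, \[ |\mathcal A_\theta\cap[1,n]| \sim \frac{\log\theta}{12}\log n \quad (n\to\infty).\]
   Context: $\lfloor x\rfloor$ is the floor of $x$; $\log$ is the natural logarithm. For real $\theta>1$ and positive integer $n$, $M'_\theta(n)=\left\lfloor 1/(\theta^{1/n}-1)\right\rfloor$, and $\mathcal A_\theta=\{n\in\mathbb N: M'_\theta(n)\neq \lfloor n/\log\theta-1/2\rfloor\}$, where $\mathbb N$ is the set of positive integers. *)

theory Defs
  imports "HOL-Analysis.Analysis" "HOL-Library.Landau_Symbols"
begin

definition Mprime :: "real \<Rightarrow> nat \<Rightarrow> int" where
  "Mprime \<theta> n = \<lfloor>1 / (\<theta> powr (1 / real n) - 1)\<rfloor>"

definition A_set :: "real \<Rightarrow> nat set" where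
  "A_set \<theta> = {n. n \<ge> 1 \<and> Mprime \<theta> n \<noteq> \<lfloor>real n / ln \<theta> - 1/2\<rfloor>}"

end

theory Submission
  imports Defs "HOL-Real_Asymp.Real_Asymp"
begin

text \<open>
  Put \<open>L = ln \<theta>\<close> and \<open>x = 1 / L\<close>. Since \<open>1 / (exp (L / n) - 1) = n / L - 1/2 + w n\<close> with
  \<open>n * w n \<longlonglongrightarrow> L / 12\<close>, membership of a large \<open>n\<close> in the exceptional set is squeezed between the
  conditions that some integer \<open>k\<close> satisfies \<open>0 < k + 1/2 - n * x \<le> c / n\<close>, with constants \<open>c\<close>
  slightly below and above \<open>L / 12\<close>. It remains to show that for almost every \<open>x\<close> and
  every rational \<open>c > 0\<close> this condition holds for asymptotically \<open>c * ln N\<close> of the \<open>n \<le> N\<close>.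

  By periodicity take \<open>x \<in> {0..<1}\<close>. The condition says that \<open>x\<close> lies in a window of length \<open>c / n\<^sup>2\<close>
  to the left of some \<open>(2 * i + 1) / (2 * n)\<close>. Windows with \<open>gcd (2 * i + 1) n > G\<close>
  have total length \<open>O(ln N / G)\<close>. For the others the second moment is estimated: for
  fixed \<open>m \<le> n\<close>, the windows with distinct end points overlap in total at most
  \<open>c\<^sup>2 / (m * n)\<close>, up to an error that sums to \<open>O(ln N)\<close>, and those with a common end point contribute
  \<open>O(G * ln N)\<close>. With \<open>N = 2 ^ k ^ 4\<close> and \<open>G = k\<^sup>2\<close> the relative variances and the relative means of
  the discarded part are summable in \<open>k\<close>, so the asymptotics hold almost everywhere along
  this subsequence, and by monotonicity along all \<open>N\<close>.
\<close>

section \<open>Overlaps of windows\<close>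

definition half_odd :: "nat \<Rightarrow> nat \<Rightarrow> real" where
  "half_odd n i = (2 * real i + 1) / (2 * real n)"

definition window :: "real \<Rightarrow> nat \<Rightarrow> nat \<Rightarrow> real set" where
  "window c n i = {half_odd n i - c / (real n)\<^sup>2 ..< half_odd n i}"

text \<open>The length of \<open>{x - a..<x} \<inter> {y - b..<y}\<close> as a function of \<open>t = x - y\<close>, for \<open>a \<le> b\<close>.\<close>
definition trapezoid :: "real \<Rightarrow> real \<Rightarrow> real \<Rightarrow> real" where
  "trapezoid a b t = max 0 (min a (min (t + b) (a - t)))"

lemma measure_lborel_Ico_max:
  "measure lborel {u ..< v :: real} = max 0 (v - u)"
  by (cases "u \<le> v") auto

lemma measure_window:
  assumes "c > 0" "n > 0"
  shows "measure lborel (window c n i) = c / (real n)\<^sup>2"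
  using assms by (simp add: window_def)

lemma measure_window_Int:
  assumes "c > 0" "0 < m" "m \<le> n"
  shows "measure lborel (window c n i \<inter> window c m j) =
           trapezoid (c / (real n)\<^sup>2) (c / (real m)\<^sup>2) (half_odd n i - half_odd m j)"
proof -
  have "c / (real n)\<^sup>2 \<le> c / (real m)\<^sup>2"
    using assms by (intro divide_left_mono power_mono) auto
  then show ?thesis
    unfolding window_def Int_atLeastLessThan measure_lborel_Ico_max trapezoid_def
    by (simp add: max_def min_def)
qed

text \<open>With \<open>d = gcd m n\<close>, \<open>m = m' * d\<close> and
  \<open>n = n' * d\<close>, two solutions satisfy \<open>(i - i') * m' = (j - j') * n'\<close>
  (here \<open>i'\<close>, \<open>j'\<close> denote the second solution), so coprimality makes
  \<open>i\<close> and \<open>i'\<close> congruent mod \<open>n'\<close>. Hence \<open>i\<close> is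
  determined by \<open>i div n'\<close>, which takes only \<open>d\<close> values below
  \<open>n\<close>, and \<open>j\<close> by \<open>i\<close>.\<close>

lemma card_fibre_le_gcd:
  fixes m n :: nat and s :: int
  assumes "0 < m" "0 < n"
  shows "card {(i, j). i < n \<and> j < m \<and> int i * int m - int j * int n = s} \<le> gcd m n"
proof -
  define d where "d = gcd m n"
  have "d > 0" using assms by (simp add: d_def)
  obtain m' n' where mn: "m = m' * d" "n = n' * d" "coprime m' n'"
    unfolding d_def using assms by (metis gcd_coprime_exists gcd_pos_nat not_gr_zero)
  have n': "n' > 0" using mn assms by (cases n') auto
  let ?A = "{(i, j). i < n \<and> j < m \<and> int i * int m - int j * int n = s}"
  have "inj_on (\<lambda>(i, j). i div n') ?A"
  proof (rule inj_onI)
    fix x y assume xy: "x \<in> ?A" "y \<in> ?A" "(\<lambda>(i, j). i div n') x = (\<lambda>(i, j). i div n') y"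
    obtain i j i' j' where x: "x = (i, j)" and y: "y = (i', j')" by (metis surj_pair)
    from xy have *: "i div n' = i' div n'" "int i * int m - int j * int n = int i' * int m - int j' * int n"
      by (auto simp: x y)
    have eq: "(int i - int i') * int m = (int j - int j') * int n"
      using * by (simp add: algebra_simps)
    then have "((int i - int i') * int m') * int d = ((int j - int j') * int n') * int d"
      by (simp add: mn algebra_simps)
    then have "(int i - int i') * int m' = (int j - int j') * int n'"
      using \<open>d > 0\<close> by simp
    then have "int n' dvd (int i - int i') * int m'" by simp
    then have "int n' dvd int i - int i'"
      using mn(3) by (simp add: coprime_commute coprime_dvd_mult_left_iff)
    then have "int i mod int n' = int i' mod int n'"
      by (simp add: mod_eq_dvd_iff)
    then have "i mod n' = i' mod n'" by (metis of_nat_eq_iff zmod_int)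
    with * have ii: "i = i'" by (metis div_mult_mod_eq)
    with eq assms show "x = y" by (simp add: x y)
  qed
  moreover have "(\<lambda>(i, j). i div n') ` ?A \<subseteq> {..<d}"
    using n' by (auto simp: mn less_mult_imp_div_less mult.commute)
  ultimately have "card ?A \<le> card {..<d}" by (intro card_inj_on_le) auto
  then show ?thesis by (simp add: d_def)
qed

text \<open>\<open>R\<close> acts as a tail integral of \<open>F\<close>: \<open>step\<close> bounds
  each term by the integral over the cell just before its grid point, and these cells are disjoint.
  The offset \<open>\<delta>\<close> allows for grids that miss the origin.\<close>

lemma telescope_le:
  fixes R F :: "real \<Rightarrow> real"
  assumes h: "h > 0" and \<delta>: "\<delta> \<ge> 0" and J: "finite J"
    and R0: "\<And>t. t \<ge> 0 \<Longrightarrow> R t \<ge> 0"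
    and anti: "\<And>s t. 0 \<le> s \<Longrightarrow> s \<le> t \<Longrightarrow> R t \<le> R s"
    and step: "\<And>t. t \<ge> h \<Longrightarrow> F t * h \<le> R (t - h) - R t"
  shows "(\<Sum>j\<in>J. F (\<delta> + (real j + 1) * h) * h) \<le> R 0"
proof -
  obtain K where K: "J \<subseteq> {..<K}" using J finite_nat_iff_bounded by auto
  have "(\<Sum>j\<in>J. F (\<delta> + (real j + 1) * h) * h)
      \<le> (\<Sum>j\<in>J. R (\<delta> + real j * h) - R (\<delta> + real (Suc j) * h))"
  proof (rule sum_mono)
    fix j
    have "\<delta> + (real j + 1) * h \<ge> h" using h \<delta> by (simp add: algebra_simps)
    from step[OF this] show "F (\<delta> + (real j + 1) * h) * h \<le> R (\<delta> + real j * h) - R (\<delta> + real (Suc j) * h)"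
      by (simp add: algebra_simps)
  qed
  also have "\<dots> \<le> (\<Sum>j<K. R (\<delta> + real j * h) - R (\<delta> + real (Suc j) * h))"
    using K h \<delta> by (intro sum_mono2) (auto intro!: anti mult_right_mono)
  also have "\<dots> = R \<delta> - R (\<delta> + real K * h)"
    by (subst sum_lessThan_telescope') simp
  also have "\<dots> \<le> R 0"
    using R0[of "\<delta> + real K * h"] anti[of 0 \<delta>] h \<delta> by simp
  finally show ?thesis .
qed

text \<open>
  The trapezoid increases up to its plateau, which contains \<open>0\<close> at its right end, so the value at a
  grid point is at most the mean over the neighbouring cell on the side of \<open>0\<close>. Omitting the point
  \<open>0\<close>, the Riemann sum is therefore bounded by the integral \<open>a * b\<close> itself; only when the grid is
  shifted by half a step do the two points next to \<open>0\<close> have to be paid for separately.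
\<close>
lemma grid_sum_trapezoid:
  fixes e :: int and K :: "int set"
  assumes h: "h > 0" and ab: "0 < a" "a \<le> b" and K: "finite K" "\<And>k. k \<in> K \<Longrightarrow> 2 * k \<noteq> e"
  shows "(\<Sum>k\<in>K. trapezoid a b (of_int (2 * k - e) * h / 2)) * h
           \<le> a * b + (if h < 2 * b then 2 * a * h else 0)"
proof -
  let ?f = "\<lambda>k. trapezoid a b (of_int (2 * k - e) * h / 2) * h"
  \<comment> \<open>The positions \<open>(2 * k - e) * h / 2\<close> are split by sign into those
    with a full cell between them and 0. As 0 itself is excluded, only the two positions at distance
    \<open>h / 2\<close> remain, and they occur only for odd \<open>e\<close>.\<close>
  define P where "P = {k\<in>K. 2 * k - e \<ge> 2}"
  define Q where "Q = {k\<in>K. 2 * k - e \<le> -2}"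
  define U where "U = {k\<in>K. \<bar>2 * k - e\<bar> = 1}"
  \<comment> \<open>\<open>Rp t\<close> and \<open>Rm t\<close> are the integrals of the trapezoid over \<open>{t..}\<close> and \<open>{..- t}\<close>.\<close>
  define Rp where "Rp = (\<lambda>t. (max 0 (a - t))\<^sup>2 / 2)"
  define Rm where "Rm = (\<lambda>t. ((max 0 (b - t))\<^sup>2 - (max 0 (b - a - t))\<^sup>2) / 2)"
  \<comment> \<open>Offset of the grid: 0 for even \<open>e\<close>, \<open>h / 2\<close> for odd
    \<open>e\<close>. The points of \<open>P\<close> and \<open>Q\<close> then have distance
    \<open>\<delta> + (j + 1) * h\<close> from 0.\<close>
  define \<delta> where "\<delta> = real_of_int (e mod 2) * h / 2"
  have \<delta>: "\<delta> \<ge> 0" using h by (simp add: \<delta>_def)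
  have K_eq: "K = P \<union> Q \<union> U"
    using K(2) by (force simp: P_def Q_def U_def)
  have fin: "finite P" "finite Q" "finite U" using K by (auto simp: P_def Q_def U_def)
  have "sum ?f P = (\<Sum>j\<in>(\<lambda>k. nat ((2 * k - e) div 2 - 1)) ` P. trapezoid a b (\<delta> + (real j + 1) * h) * h)"
  proof (subst sum.reindex)
    show "inj_on (\<lambda>k. nat ((2 * k - e) div 2 - 1)) P"
      by (rule inj_onI) (auto simp: P_def)
    show "sum ?f P = sum ((\<lambda>j. trapezoid a b (\<delta> + (real j + 1) * h) * h) \<circ> (\<lambda>k. nat ((2 * k - e) div 2 - 1))) P"
    proof (rule sum.cong[OF refl])
      fix k assume "k \<in> P"
      then have k: "2 * k - e \<ge> 2" by (simp add: P_def)
      define q where "q = (2 * k - e) div 2"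
      have q: "2 * k - e = 2 * q + e mod 2" "q \<ge> 1" using k unfolding q_def by presburger+
      then have "real_of_int (2 * k - e) * h / 2 = \<delta> + (real (nat (q - 1)) + 1) * h"
        by (simp add: \<delta>_def algebra_simps add_divide_distrib)
      then show "?f k = ((\<lambda>j. trapezoid a b (\<delta> + (real j + 1) * h) * h) \<circ> (\<lambda>k. nat ((2 * k - e) div 2 - 1))) k"
        unfolding o_def q_def by (simp only:)
    qed
  qed
  also have "\<dots> \<le> Rp 0"
  proof (rule telescope_le[OF h \<delta>])
    fix t assume "h \<le> t"
    then show "trapezoid a b t * h \<le> Rp (t - h) - Rp t"
    proof (cases "t < a")
      case True
      then have *: "trapezoid a b t = a - t" using \<open>h \<le> t\<close> h ab by (simp add: trapezoid_def)
      show ?thesis unfolding * using True h by (simp add: Rp_def power2_eq_square field_simps)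
    next
      case False
      then have "trapezoid a b t = 0" by (simp add: trapezoid_def)
      then show ?thesis using False h by (simp add: Rp_def)
    qed
  qed (use fin in \<open>auto simp: Rp_def intro!: power_mono\<close>)
  finally have p: "sum ?f P \<le> a\<^sup>2 / 2" using ab by (simp add: Rp_def)
  have "sum ?f Q = (\<Sum>j\<in>(\<lambda>k. nat ((e - 2 * k) div 2 - 1)) ` Q. trapezoid a b (- (\<delta> + (real j + 1) * h)) * h)"
  proof (subst sum.reindex)
    show "inj_on (\<lambda>k. nat ((e - 2 * k) div 2 - 1)) Q"
      by (rule inj_onI) (auto simp: Q_def)
    show "sum ?f Q = sum ((\<lambda>j. trapezoid a b (- (\<delta> + (real j + 1) * h)) * h) \<circ> (\<lambda>k. nat ((e - 2 * k) div 2 - 1))) Q"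
    proof (rule sum.cong[OF refl])
      fix k assume "k \<in> Q"
      then have k: "e - 2 * k \<ge> 2" by (simp add: Q_def)
      define q where "q = (e - 2 * k) div 2"
      have q: "2 * k - e = - (2 * q + e mod 2)" "q \<ge> 1" using k unfolding q_def by presburger+
      then have "real_of_int (2 * k - e) * h / 2 = - (\<delta> + (real (nat (q - 1)) + 1) * h)"
        unfolding q(1) using q(2) by (simp add: \<delta>_def field_simps)
      then show "?f k = ((\<lambda>j. trapezoid a b (- (\<delta> + (real j + 1) * h)) * h) \<circ> (\<lambda>k. nat ((e - 2 * k) div 2 - 1))) k"
        unfolding o_def q_def by (simp only:)
    qed
  qed
  also have "\<dots> \<le> Rm 0"
  proof (rule telescope_le[OF h \<delta>, where F = "\<lambda>t. trapezoid a b (- t)" and R = Rm])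
    fix t :: real
    show "Rm t \<ge> 0" using ab by (auto simp: Rm_def intro!: power_mono)
  next
    fix s t :: real assume "0 \<le> s" "s \<le> t"
    \<comment> \<open>Monotone because the function is twice an antiderivative of the nonnegative
      function \<open>max 0 (min a v)\<close>.\<close>
    have *: "(max 0 x)\<^sup>2 - (max 0 (x - a))\<^sup>2 \<le> (max 0 y)\<^sup>2 - (max 0 (y - a))\<^sup>2" if "x \<le> y" for x y
    proof (cases "x \<le> a")
      case True
      show ?thesis
      proof (cases "y \<le> a")
        case True
        have "(max 0 x)\<^sup>2 \<le> (max 0 y)\<^sup>2" using that by (intro power_mono) auto
        with True \<open>x \<le> a\<close> show ?thesis by simp
      next
        case False
        have "(max 0 x)\<^sup>2 \<le> a\<^sup>2" using True ab by (intro power_mono) auto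
        moreover have "y\<^sup>2 - (y - a)\<^sup>2 = a\<^sup>2 + 2 * a * (y - a)" by (simp add: power2_eq_square algebra_simps)
        moreover have "2 * a * (y - a) \<ge> 0" using False ab by simp
        ultimately have "(max 0 x)\<^sup>2 \<le> y\<^sup>2 - (y - a)\<^sup>2" by linarith
        then show ?thesis using True False ab by simp
      qed
    next
      case False
      have "a * x \<le> a * y" using that ab by simp
      then show ?thesis using False that ab by (simp add: power2_eq_square algebra_simps)
    qed
    show "Rm t \<le> Rm s" 
      unfolding Rm_def using *[of "b - t" "b - s"] \<open>s \<le> t\<close>
      by (intro divide_right_mono) (simp_all add: algebra_simps)
  next
    fix t assume t: "h \<le> t"
    define v where "v = b - t"
    \<comment> \<open>In the variable \<open>v = b - t\<close> the left branch is
      \<open>max 0 (min a v)\<close>, which is nondecreasing, so its value at \<open>v\<close> is at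
      most its mean over the cell from \<open>v\<close> to \<open>v + h\<close>. The cases locate
      this cell relative to the kinks at 0 and \<open>a\<close>.\<close>
    have *: "max 0 (min a v) * h \<le> ((max 0 (v + h))\<^sup>2 - (max 0 (v + h - a))\<^sup>2 - (max 0 v)\<^sup>2 + (max 0 (v - a))\<^sup>2) / 2"
    proof -
      consider "v \<le> 0" | "0 < v" "v \<le> a" "v + h \<le> a" | "0 < v" "v \<le> a" "v + h > a" | "v > a" by linarith
      then show ?thesis
      proof cases
        case 1
        then have "(max 0 (v + h - a))\<^sup>2 \<le> (max 0 (v + h))\<^sup>2" using ab by (intro power_mono) auto
        then show ?thesis using 1 ab h by simp
      next
        case 2 then show ?thesis using h ab by (simp add: power2_eq_square field_simps)
      next
        case 3
        have "(v + h)\<^sup>2 - (v + h - a)\<^sup>2 - v\<^sup>2 - 2 * v * h = h\<^sup>2 - (v + h - a)\<^sup>2"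
          by (simp add: power2_eq_square algebra_simps)
        moreover have "(v + h - a)\<^sup>2 \<le> h\<^sup>2" using 3 by (intro power_mono) auto
        ultimately have "2 * v * h \<le> (v + h)\<^sup>2 - (v + h - a)\<^sup>2 - v\<^sup>2" by linarith
        then show ?thesis using 3 h ab by simp
      next
        case 4 then show ?thesis using h ab by (simp add: power2_eq_square field_simps)
      qed
    qed
    have "trapezoid a b (- t) = max 0 (min a v)"
      using t h ab by (simp add: trapezoid_def v_def)
    then show "trapezoid a b (- t) * h \<le> Rm (t - h) - Rm t"
      using * by (simp add: Rm_def v_def field_simps)
  qed (use fin in auto)
  finally have q: "sum ?f Q \<le> a * b - a\<^sup>2 / 2"
    using ab by (simp add: Rm_def power2_eq_square field_simps)
  \<comment> \<open>For \<open>h \<ge> 2 * b\<close> both points at distance \<open>h / 2\<close>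
    are outside the support of the trapezoid; otherwise there are at most two of them, each of
    height at most \<open>a\<close>.\<close>
  have u: "sum ?f U \<le> (if h < 2 * b then 2 * a * h else 0)"
  proof (cases "h < 2 * b")
    case True
    have "U \<subseteq> {(e + 1) div 2, (e - 1) div 2}" by (auto simp: U_def)
    then have "card U \<le> card {(e + 1) div 2, (e - 1) div 2}" by (intro card_mono) auto
    also have "\<dots> \<le> 2" by (simp add: card_insert_if)
    finally have "card U \<le> 2" .
    have "sum ?f U \<le> of_nat (card U) * (a * h)"
      using h ab by (intro sum_bounded_above mult_right_mono) (auto simp: trapezoid_def)
    also have "\<dots> \<le> 2 * (a * h)" using \<open>card U \<le> 2\<close> h ab by (intro mult_right_mono) auto
    finally show ?thesis using True by simp
  next
    case False
    have "?f k = 0" if "k \<in> U" for k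
    proof -
      from that have "2 * k - e = 1 \<or> 2 * k - e = -1" by (auto simp: U_def)
      then show ?thesis
      proof
        assume *: "2 * k - e = 1"
        show ?thesis unfolding * using False ab by (simp add: trapezoid_def)
      next
        assume *: "2 * k - e = -1"
        show ?thesis unfolding * using False ab by (simp add: trapezoid_def)
      qed
    qed
    then have "sum ?f U = 0" by (intro sum.neutral) blast
    then show ?thesis using False by simp
  qed
  have "sum ?f K = sum ?f P + sum ?f Q + sum ?f U"
    unfolding K_eq using fin
    by (subst sum.union_disjoint; (subst sum.union_disjoint)?) (auto simp: P_def Q_def U_def)
  then have "sum ?f K \<le> a * b + (if h < 2 * b then 2 * a * h else 0)"
    using p q u by linarith
  then show ?thesis by (simp only: sum_distrib_right)
qed

lemma sum_over_fibres_le: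
  fixes g :: "'b \<Rightarrow> real"
  assumes "finite A" "\<And>k. card {x \<in> A. \<kappa> x = k} \<le> d" "\<And>k. g k \<ge> 0"
  shows "(\<Sum>x\<in>A. g (\<kappa> x)) \<le> real d * (\<Sum>k\<in>\<kappa> ` A. g k)"
proof -
  have "(\<Sum>x\<in>A. g (\<kappa> x)) = (\<Sum>k\<in>\<kappa> ` A. \<Sum>x\<in>{x \<in> A. \<kappa> x = k}. g (\<kappa> x))"
    using assms(1) by (rule sum.image_gen)
  also have "\<dots> = (\<Sum>k\<in>\<kappa> ` A. real (card {x \<in> A. \<kappa> x = k}) * g k)"
    by (intro sum.cong) auto
  also have "\<dots> \<le> (\<Sum>k\<in>\<kappa> ` A. real d * g k)"
    using assms by (intro sum_mono mult_right_mono) auto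
  finally show ?thesis by (simp add: sum_distrib_left)
qed

text \<open>The cost of the two half-step points in \<open>grid_sum_trapezoid\<close>, for
  \<open>a = c / n^2\<close>, \<open>b = c / m^2\<close> and step
  \<open>h = gcd m n / (m * n)\<close>, multiplied by \<open>gcd m n / h\<close>. The condition is
  \<open>h < 2 * b\<close> cleared of denominators.\<close>

definition excess :: "real \<Rightarrow> nat \<Rightarrow> nat \<Rightarrow> real" where
  "excess c m n = (if real (gcd m n) * real m < 2 * c * real n
                   then 2 * c * real (gcd m n) / (real n)\<^sup>2 else 0)"

lemma excess_nonneg: "c > 0 \<Longrightarrow> excess c m n \<ge> 0"
  by (simp add: excess_def)

text \<open>The differences of end points lie on a grid of step \<open>h = d / (m * n)\<close> with
  \<open>d = gcd m n\<close>, and each value comes from at most \<open>d\<close> pairs. The Riemann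
  sum bound \<open>a * b / h\<close>, taken \<open>d\<close> times, is \<open>m * n * a * b\<close>,
  the product of the total lengths \<open>c / n\<close> and \<open>c / m\<close>, as if the two
  families were independent.\<close>

lemma distinct_overlap_sum_le:
  assumes c: "c > 0" and mn: "0 < m" "m \<le> n"
  shows "(\<Sum>(i, j) | i < n \<and> j < m \<and> half_odd n i \<noteq> half_odd m j. measure lborel (window c n i \<inter> window c m j))
           \<le> (c / real n) * (c / real m) + excess c m n"
proof -
  define d where "d = gcd m n"
  \<comment> \<open>The numerator \<open>(2 * i + 1) * m - (2 * j + 1) * n\<close> equals
    \<open>2 * (i * m - j * n) - (n - m)\<close>. Divided by \<open>d\<close> it becomes
    \<open>2 * \<kappa> - e\<close>, so the parity of \<open>e\<close> decides whether the grid
    passes through 0.\<close>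
  define e where "e = (int n - int m) div int d"
  define a where "a = c / (real n)\<^sup>2"
  define b where "b = c / (real m)\<^sup>2"
  define h where "h = real d / (real m * real n)"
  define A where "A = {(i, j). i < n \<and> j < m \<and> half_odd n i \<noteq> half_odd m j}"
  define \<kappa> where "\<kappa> = (\<lambda>(i, j). (int i * int m - int j * int n) div int d)"
  define g where "g = (\<lambda>k. trapezoid a b (of_int (2 * k - e) * h / 2))"
  have n: "0 < n" and d: "d > 0" using mn by (auto simp: d_def)
  have h: "h > 0" using d mn n by (simp add: h_def)
  have ab: "0 < a" "a \<le> b"
    using c mn by (auto simp: a_def b_def intro!: divide_left_mono power_mono)
  have finA: "finite A" unfolding A_def by (rule finite_subset[of _ "{..<n} \<times> {..<m}"]) auto
  have dvd: "int d dvd int n" "int d dvd int m" by (auto simp: d_def)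
  have e: "int d * e = int n - int m" unfolding e_def using dvd by (metis dvd_diff dvd_mult_div_cancel)
  have \<kappa>: "int d * \<kappa> (i, j) = int i * int m - int j * int n" for i j
    unfolding \<kappa>_def prod.case using dvd by (intro dvd_mult_div_cancel dvd_diff dvd_mult)
  have diff: "half_odd n i - half_odd m j = of_int (2 * \<kappa> (i, j) - e) * h / 2" for i j
  proof -
    have "int d * (2 * \<kappa> (i, j) - e) = (2 * int i + 1) * int m - (2 * int j + 1) * int n"
      using \<kappa>[of i j] e by (simp add: algebra_simps)
    then have "real_of_int (int d * (2 * \<kappa> (i, j) - e)) = of_int ((2 * int i + 1) * int m - (2 * int j + 1) * int n)"
      by (simp only:)
    then have *: "real d * of_int (2 * \<kappa> (i, j) - e) = (2 * real i + 1) * real m - (2 * real j + 1) * real n"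
      by simp
    have "r * h / 2 = (real d * r) / (2 * real m * real n)" for r
      by (simp add: h_def mult_ac)
    from this[of "of_int (2 * \<kappa> (i, j) - e)"]
    have "of_int (2 * \<kappa> (i, j) - e) * h / 2 = ((2 * real i + 1) * real m - (2 * real j + 1) * real n) / (2 * real m * real n)"
      unfolding * .
    then show ?thesis using mn n by (simp add: half_odd_def field_simps)
  qed
  have "(\<Sum>(i, j)\<in>A. measure lborel (window c n i \<inter> window c m j)) = (\<Sum>x\<in>A. g (\<kappa> x))"
    by (intro sum.cong) (auto simp: measure_window_Int[OF c mn] diff g_def a_def b_def)
  also have "\<dots> \<le> real d * (\<Sum>k\<in>\<kappa> ` A. g k)"
  proof (rule sum_over_fibres_le[OF finA])
    fix k
    have "{x \<in> A. \<kappa> x = k} \<subseteq> {(i, j). i < n \<and> j < m \<and> int i * int m - int j * int n = int d * k}"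
      unfolding A_def by (auto simp: \<kappa>[symmetric])
    then have "card {x \<in> A. \<kappa> x = k} \<le> card {(i, j). i < n \<and> j < m \<and> int i * int m - int j * int n = int d * k}"
      by (rule card_mono[rotated]) (rule finite_subset[of _ "{..<n} \<times> {..<m}"], auto)
    also have "\<dots> \<le> d" unfolding d_def by (rule card_fibre_le_gcd) (use mn n in auto)
    finally show "card {x \<in> A. \<kappa> x = k} \<le> d" .
  qed (simp add: g_def trapezoid_def)
  also have "\<dots> = real d / h * ((\<Sum>k\<in>\<kappa> ` A. g k) * h)" using h by simp
  also have "\<dots> \<le> real d / h * (a * b + (if h < 2 * b then 2 * a * h else 0))"
  proof (rule mult_left_mono)
    show "(\<Sum>k\<in>\<kappa> ` A. g k) * h \<le> a * b + (if h < 2 * b then 2 * a * h else 0)"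
      unfolding g_def
    proof (rule grid_sum_trapezoid[OF h ab])
      show "2 * k \<noteq> e" if "k \<in> \<kappa> ` A" for k
      proof -
        from that obtain i j where k: "k = \<kappa> (i, j)" and "half_odd n i \<noteq> half_odd m j" by (auto simp: A_def)
        then show ?thesis using diff[of i j] by auto
      qed
    qed (use finA in auto)
  qed (use h in auto)
  also have "\<dots> = (c / real n) * (c / real m) + excess c m n"
  proof -
    have "h < 2 * b \<longleftrightarrow> real d * real m < 2 * c * real n"
      using mn n by (simp add: h_def b_def field_simps power2_eq_square)
    moreover have "real d / h = real m * real n" using d by (simp add: h_def)
    moreover have "real m * real n * (a * b) = (c / real n) * (c / real m)"
      using mn n by (simp add: a_def b_def field_simps power2_eq_square)
    moreover have "real m * real n * (2 * a * h) = 2 * c * real d / (real n)\<^sup>2"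
      using mn n by (simp add: a_def h_def field_simps power2_eq_square)
    ultimately show ?thesis
      by (simp add: excess_def d_def distrib_left)
  qed
  finally show ?thesis by (simp add: A_def)
qed

section \<open>The total excess over all pairs of denominators\<close>

lemma sum_inverse_squares_tail_le:
  assumes "G \<ge> 1"
  shows "(\<Sum>g\<in>{G<..N}. 1 / (real g)\<^sup>2) \<le> 1 / real G"
proof (cases "G \<le> N")
  case True
  then have "(\<Sum>g\<in>{G<..N}. 1 / (real g)\<^sup>2) \<le> 1 / real G - 1 / real N"
  proof (induction N rule: dec_induct)
    case (step N)
    have "{G<..Suc N} = insert (Suc N) {G<..N}" using step by auto
    then have "(\<Sum>g\<in>{G<..Suc N}. 1 / (real g)\<^sup>2) = 1 / (real (Suc N))\<^sup>2 + (\<Sum>g\<in>{G<..N}. 1 / (real g)\<^sup>2)"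
      by simp
    moreover have "1 / (real (Suc N))\<^sup>2 \<le> 1 / (real (Suc N) * real N)"
      using step assms by (intro divide_left_mono) (auto simp: power2_eq_square)
    moreover have "1 / (real (Suc N) * real N) = 1 / real N - 1 / real (Suc N)"
      using step assms by (simp add: field_simps)
    ultimately show ?case using step by linarith
  qed simp
  moreover have "1 / real N \<ge> 0" by simp
  ultimately show ?thesis by linarith
qed simp

lemma sum_inverse_squares_le: "(\<Sum>d=1..N. 1 / (real d)\<^sup>2) \<le> 2"
proof (cases "N \<ge> 1")
  case True
  then have "{1..N} = insert 1 {1<..N}" by auto
  then show ?thesis using sum_inverse_squares_tail_le[of 1 N] by simp
qed simp

text \<open>Pairs are written as \<open>n = d * n'\<close>, \<open>m = d * m'\<close> with
  \<open>d\<close> the gcd. A nonzero excess is \<open>2 * c / (d * n'^2)\<close> and requires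
  \<open>d * m' < 2 * c * n'\<close>, which leaves at most \<open>2 * c * n' / d\<close> values of
  \<open>m'\<close>. What remains is \<open>4 * c^2 / (n' * d^2)\<close>, a harmonic sum in
  \<open>n'\<close> times a convergent sum in \<open>d\<close>.\<close>

lemma sum_excess_le:
  assumes c: "c > 0"
  shows "(\<Sum>n=1..N. \<Sum>m=1..n. excess c m n) \<le> 8 * c\<^sup>2 * harm N"
proof -
  define P where "P = {(n, m). n \<in> {1..N} \<and> m \<in> {1..n} \<and> real (gcd m n) * real m < 2 * c * real n}"
  define D where "D = (\<lambda>(n', d). {m'. 1 \<le> m' \<and> real d * real m' < 2 * c * real n'})"
  define \<phi> where "\<phi> = (\<lambda>(n, m :: nat). ((n div gcd m n, gcd m n), m div gcd m n))"
  define w where "w = (\<lambda>((n', d), m' :: nat). 2 * c / (real d * (real n')\<^sup>2))"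
  have finP: "finite P" unfolding P_def by (rule finite_subset[of _ "{1..N} \<times> {1..N}"]) auto
  have D: "D (n', d) \<subseteq> {1..nat \<lfloor>2 * c * real n' / real d\<rfloor>}" if "d \<ge> 1" for n' d
  proof
    fix m assume "m \<in> D (n', d)"
    then have "1 \<le> m" "real m \<le> 2 * c * real n' / real d"
      using that by (auto simp: D_def field_simps)
    then show "m \<in> {1..nat \<lfloor>2 * c * real n' / real d\<rfloor>}" by (simp add: le_nat_floor)
  qed
  have finD: "finite (D x)" if "x \<in> {1..N} \<times> {1..N}" for x
    using that D by (cases x) (auto intro: finite_subset)
  have "(\<Sum>n=1..N. \<Sum>m=1..n. excess c m n) = (\<Sum>(n, m)\<in>(SIGMA n:{1..N}. {1..n}). excess c m n)"
    by (rule sum.Sigma) auto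
  also have "\<dots> = (\<Sum>(n, m)\<in>P. excess c m n)"
    by (rule sum.mono_neutral_right) (auto simp: P_def excess_def split: if_splits)
  also have "\<dots> = (\<Sum>x\<in>P. w (\<phi> x))"
  proof (rule sum.cong[OF refl])
    fix x assume "x \<in> P"
    then obtain n m where x: "x = (n, m)" and nm: "n \<in> {1..N}" "m \<in> {1..n}"
        "real (gcd m n) * real m < 2 * c * real n"
      by (auto simp: P_def)
    define n' where "n' = n div gcd m n"
    have n: "n = gcd m n * n'" by (simp add: n'_def)
    have "real n = real (gcd m n) * real n'" by (subst n) simp
    moreover have "gcd m n > 0" using nm by auto
    ultimately have "2 * c * real (gcd m n) / (real n)\<^sup>2 = 2 * c / (real (gcd m n) * (real n')\<^sup>2)"
      by (simp add: power2_eq_square)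
    then show "(case x of (n, m) \<Rightarrow> excess c m n) = w (\<phi> x)"
      using nm by (simp add: x w_def \<phi>_def excess_def n'_def)
  qed
  also have "\<dots> = (\<Sum>x\<in>\<phi> ` P. w x)"
  proof (subst sum.reindex)
    show "inj_on \<phi> P"
    proof (rule inj_onI)
      fix x y assume *: "x \<in> P" "y \<in> P" "\<phi> x = \<phi> y"
      obtain n m n' m' where [simp]: "x = (n, m)" "y = (n', m')" by (metis surj_pair)
      from * have "n div gcd m n = n' div gcd m' n'" "gcd m n = gcd m' n'" "m div gcd m n = m' div gcd m' n'"
        by (auto simp: \<phi>_def)
      then have "n = n'" "m = m'" by (metis dvd_div_mult_self gcd_dvd1 gcd_dvd2)+
      then show "x = y" by simp
    qed
  qed simp
  also have "\<dots> \<le> (\<Sum>x\<in>Sigma ({1..N} \<times> {1..N}) D. w x)"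
  proof (rule sum_mono2)
    show "finite (Sigma ({1..N} \<times> {1..N}) D)" using finD by auto
    show "\<phi> ` P \<subseteq> Sigma ({1..N} \<times> {1..N}) D"
    proof
      fix y assume "y \<in> \<phi> ` P"
      then obtain n m where y: "y = \<phi> (n, m)" and nm: "1 \<le> n" "n \<le> N" "1 \<le> m" "m \<le> n"
        "real (gcd m n) * real m < 2 * c * real n"
        by (auto simp: P_def)
      define d where "d = gcd m n"
      have d: "d > 0" using nm by (simp add: d_def)
      obtain n' m' where n': "n = d * n'" and m': "m = d * m'"
        unfolding d_def by (metis dvdE gcd_dvd1 gcd_dvd2)
      have "real d * (real d * real m') < real d * (2 * c * real n')"
        using nm(5) unfolding d_def[symmetric] by (simp add: n' m' algebra_simps)
      then have *: "real d * real m' < 2 * c * real n'" using d by simp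
      have "n' \<ge> 1" "m' \<ge> 1" using nm n' m' by (auto simp: Suc_le_eq intro: gr0I)
      moreover have "n' \<le> n" "d \<le> n" using \<open>n' \<ge> 1\<close> d by (auto simp: n')
      moreover have "y = ((n', d), m')"
        unfolding y \<phi>_def using d by (simp add: d_def[symmetric]) (simp add: n' m')
      ultimately show "y \<in> Sigma ({1..N} \<times> {1..N}) D"
        using * d nm by (auto simp: D_def)
    qed
  qed (use c in \<open>auto simp: w_def\<close>)
  also have "\<dots> = (\<Sum>x\<in>{1..N} \<times> {1..N}. \<Sum>y\<in>D x. w (x, y))"
    by (subst sum.Sigma) (use finD in auto)
  also have "\<dots> \<le> (\<Sum>(n', d)\<in>{1..N} \<times> {1..N}. 4 * c\<^sup>2 * (1 / real n') * (1 / (real d)\<^sup>2))"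
  proof (rule sum_mono, clarify)
    fix n' d assume nd: "n' \<in> {1..N}" "d \<in> {1..N}"
    have "real (card (D (n', d))) \<le> real (card {1..nat \<lfloor>2 * c * real n' / real d\<rfloor>})"
      using D[of d n'] nd by (intro of_nat_mono card_mono) auto
    also have "\<dots> \<le> 2 * c * real n' / real d" using c by simp
    finally have card: "real (card (D (n', d))) \<le> 2 * c * real n' / real d" .
    have "(\<Sum>y\<in>D (n', d). w ((n', d), y)) = real (card (D (n', d))) * (2 * c / (real d * (real n')\<^sup>2))"
      by (simp add: w_def)
    also have "\<dots> \<le> 2 * c * real n' / real d * (2 * c / (real d * (real n')\<^sup>2))"
      using card c by (intro mult_right_mono) auto
    also have "\<dots> = 4 * c\<^sup>2 * (1 / real n') * (1 / (real d)\<^sup>2)"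
      using nd by (simp add: field_simps power2_eq_square)
    finally show "(\<Sum>y\<in>D (n', d). w ((n', d), y)) \<le> 4 * c\<^sup>2 * (1 / real n') * (1 / (real d)\<^sup>2)" .
  qed
  also have "\<dots> = 4 * c\<^sup>2 * (\<Sum>n'=1..N. 1 / real n') * (\<Sum>d=1..N. 1 / (real d)\<^sup>2)"
    by (simp only: mult.assoc sum_product) (simp add: sum_distrib_left sum.cartesian_product case_prod_unfold)
  also have "\<dots> = 4 * c\<^sup>2 * harm N * (\<Sum>d=1..N. 1 / (real d)\<^sup>2)"
    by (simp add: harm_def inverse_eq_divide)
  also have "\<dots> \<le> 4 * c\<^sup>2 * harm N * 2"
    using sum_inverse_squares_le by (intro mult_left_mono) (auto simp: harm_nonneg)
  finally show ?thesis by simp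
qed

section \<open>First and second moments\<close>

definition indices :: "nat \<Rightarrow> nat \<Rightarrow> (nat \<times> nat) set" where
  "indices n0 N = (SIGMA n:{n0..N}. {..<n})"

text \<open>
  Points \<open>(2 * i + 1) / (2 * n)\<close> whose fraction cancels by a large factor are
  responsible for a variance of order \<open>(ln N)\<^sup>2\<close>; they are split off and treated by their mean alone.
\<close>
definition low :: "nat \<Rightarrow> (nat \<times> nat) set" where
  "low G = {(n, i). gcd (2 * i + 1) n \<le> G}"

abbreviation windowp :: "real \<Rightarrow> nat \<times> nat \<Rightarrow> real set" where
  "windowp c p \<equiv> window c (fst p) (snd p)"

abbreviation half_oddp :: "nat \<times> nat \<Rightarrow> real" where
  "half_oddp p \<equiv> half_odd (fst p) (snd p)"

lemma finite_indices [simp]: "finite (indices n0 N)"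
  by (simp add: indices_def)

lemma window_fmeasurable: "window c n i \<in> fmeasurable lborel"
  unfolding window_def by (cases "half_odd n i - c / (real n)\<^sup>2 \<le> half_odd n i") (auto intro!: fmeasurableI)

lemma window_sets [measurable]: "window c n i \<in> sets borel"
  by (simp add: window_def)

section \<open>Counting coincident points and large common divisors\<close>

lemma half_odd_eq_iff:
  assumes "n > 0" "m > 0"
  shows "half_odd m j = half_odd n i \<longleftrightarrow> (2 * j + 1) * n = (2 * i + 1) * m"
proof -
  have "half_odd m j = half_odd n i \<longleftrightarrow> real ((2 * j + 1) * n) = real ((2 * i + 1) * m)"
  proof -
    have "half_odd k l = (2 * real l + 1) / real k / 2" for k l by (simp add: half_odd_def)
    then show ?thesis using assms by (simp add: frac_eq_eq, simp add: algebra_simps)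
  qed
  then show ?thesis by (simp only: of_nat_eq_iff)
qed

text \<open>Let \<open>a / n'\<close> be \<open>(2 * i + 1) / n\<close> in lowest terms, with
  \<open>n = n' * g\<close>. Any other representation has a denominator \<open>m\<close> divisible
  by \<open>n'\<close>, and \<open>m\<close> determines \<open>j\<close>; there are \<open>g\<close>
  positive multiples of \<open>n'\<close> up to \<open>n\<close>.\<close>

lemma card_same_point_le:
  assumes "n > 0"
  shows "card {(m, j). 0 < m \<and> m \<le> n \<and> j < m \<and> half_odd m j = half_odd n i} \<le> gcd (2 * i + 1) n"
proof -
  define g where "g = gcd (2 * i + 1) n"
  define A where "A = {(m, j). 0 < m \<and> m \<le> n \<and> j < m \<and> half_odd m j = half_odd n i}"
  have g: "g > 0" by (simp add: g_def)
  obtain a n' where an: "2 * i + 1 = a * g" "n = n' * g" "coprime a n'"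
    unfolding g_def using assms by (metis gcd_coprime_exists gcd_pos_nat not_gr_zero)
  have n': "n' > 0" using an assms by (cases n') auto
  have A: "n' dvd m \<and> (2 * j + 1) * n' = a * m" if "(m, j) \<in> A" for m j
  proof -
    have "(2 * j + 1) * n = (2 * i + 1) * m"
      using that assms by (auto simp: A_def half_odd_eq_iff)
    then have "(2 * j + 1) * n' * g = a * m * g"
      unfolding an(1) an(2) by (simp only: ac_simps)
    then have eq: "(2 * j + 1) * n' = a * m" using g by simp
    then have "n' dvd a * m" by (metis dvd_triv_right)
    then show ?thesis using eq an(3) by (metis coprime_commute coprime_dvd_mult_right_iff)
  qed
  have "inj_on (\<lambda>p. fst p div n') A"
  proof (rule inj_onI)
    fix x y assume xy: "x \<in> A" "y \<in> A" "fst x div n' = fst y div n'"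
    obtain m j l k where [simp]: "x = (m, j)" "y = (l, k)" by (metis surj_pair)
    have "n' dvd m" "n' dvd l" "m div n' = l div n'" using xy A[of m j] A[of l k] by simp_all
    then have "m = l" by (metis dvd_div_mult_self)
    moreover from this have "(2 * j + 1) * n' = (2 * k + 1) * n'" using xy A[of m j] A[of l k] by simp
    then have "j = k" using n' by simp
    ultimately show "x = y" by simp
  qed
  moreover have "(\<lambda>p. fst p div n') ` A \<subseteq> {1..g}"
  proof clarify
    fix m j assume mj: "(m, j) \<in> A"
    then have "m \<le> n' * g" "0 < m" "n' dvd m" using A by (auto simp: A_def an(2))
    then show "fst (m, j) div n' \<in> {1..g}"
      using n' by (auto simp: Suc_le_eq div_greater_zero_iff dvd_imp_le elim!: dvdE)
  qed
  ultimately have "card A \<le> card {1..g}" by (intro card_inj_on_le) auto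
  then show ?thesis by (simp add: A_def g_def)
qed

text \<open>A divisor of an odd number is odd, so 2 is invertible mod \<open>g\<close> and all such
  \<open>i\<close> share one residue class mod \<open>g\<close>. Each block of \<open>g\<close>
  consecutive integers contains one member of that class.\<close>

lemma card_dvd_odd_le:
  assumes "g dvd n" "g > 0"
  shows "card {i. i < n \<and> g dvd 2 * i + 1} \<le> n div g"
proof -
  let ?A = "{i. i < n \<and> g dvd 2 * i + 1}"
  have "inj_on (\<lambda>i. i div g) ?A"
  proof (rule inj_onI)
    fix x y assume xy: "x \<in> ?A" "y \<in> ?A" "x div g = y div g"
    have "coprime g 2" using xy(1) by (metis coprime_right_2_iff_odd dvd_trans even_plus_one_iff dvd_triv_left mem_Collect_eq)
    have "int g dvd int (2 * x + 1) - int (2 * y + 1)" using xy by (intro dvd_diff) (auto simp only: int_dvd_int_iff)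
    then have "int g dvd 2 * (int x - int y)" by (simp add: algebra_simps)
    moreover have "coprime (int g) 2" using \<open>coprime g 2\<close> by (simp add: coprime_right_2_iff_odd)
    ultimately have "int g dvd int x - int y" by (metis coprime_dvd_mult_right_iff)
    then have "int x mod int g = int y mod int g" by (simp add: mod_eq_dvd_iff)
    then have "x mod g = y mod g" by (metis of_nat_eq_iff zmod_int)
    with xy show "x = y" by (metis div_mult_mod_eq)
  qed
  moreover have "(\<lambda>i. i div g) ` ?A \<subseteq> {..<n div g}"
    using assms by (auto elim!: dvdE simp: less_mult_imp_div_less mult.commute)
  ultimately have "card ?A \<le> card {..<n div g}" by (intro card_inj_on_le) auto
  then show ?thesis by simp
qed

section \<open>First moments\<close>

lemma sum_measure_window_indices:
  assumes "c > 0" "n0 > 0"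
  shows "(\<Sum>p\<in>indices n0 N. measure lborel (windowp c p)) = (\<Sum>n=n0..N. c / real n)"
proof -
  have "(\<Sum>p\<in>indices n0 N. measure lborel (windowp c p)) = (\<Sum>n=n0..N. \<Sum>i<n. measure lborel (window c n i))"
    unfolding indices_def by (subst sum.Sigma) (auto simp: case_prod_unfold)
  also have "\<dots> = (\<Sum>n=n0..N. c / real n)"
    using assms by (intro sum.cong) (auto simp: measure_window power2_eq_square)
  finally show ?thesis .
qed

lemma sum_inverse_multiples_le:
  assumes "g > 0"
  shows "(\<Sum>n | n \<in> {1..N} \<and> g dvd n. 1 / real n) \<le> harm N / real g"
proof -
  have "{n. n \<in> {1..N} \<and> g dvd n} \<subseteq> (\<lambda>k. g * k) ` {1..N}"
  proof clarify
    fix n assume "n \<in> {1..N}" "g dvd n"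
    then obtain k where k: "n = g * k" "1 \<le> n" "n \<le> N" by (auto elim!: dvdE)
    moreover have "k \<le> g * k" using assms by simp
    then have "k \<le> N" using k by linarith
    ultimately show "n \<in> (\<lambda>k. g * k) ` {1..N}" by (auto simp: Suc_le_eq intro!: imageI)
  qed
  then have "(\<Sum>n | n \<in> {1..N} \<and> g dvd n. 1 / real n) \<le> (\<Sum>n\<in>(\<lambda>k. g * k) ` {1..N}. 1 / real n)"
    by (intro sum_mono2) auto
  also have "\<dots> = (\<Sum>k=1..N. 1 / real (g * k))"
    using assms by (subst sum.reindex) (auto intro!: inj_onI)
  also have "\<dots> = harm N / real g"
    by (simp add: harm_def sum_divide_distrib inverse_eq_divide mult.commute)
  finally show ?thesis .
qed

text \<open>Union bound over the possible values \<open>g > G\<close> of the gcd: at most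
  \<open>n / g\<close> indices, each with a window of length \<open>c / n^2\<close>, contribute
  \<open>c / (g * n)\<close>. Summing over the multiples \<open>n\<close> of \<open>g\<close> gains
  a second factor \<open>1 / g\<close>, and the tail of the inverse squares yields
  \<open>1 / G\<close>.\<close>

lemma sum_measure_window_high_le:
  assumes c: "c > 0" and n0: "n0 > 0" and G: "G \<ge> 1"
  shows "(\<Sum>p\<in>indices n0 N - low G. measure lborel (windowp c p)) \<le> c * harm N / real G"
proof -
  have card: "real (card {i. i < n \<and> gcd (2 * i + 1) n > G}) \<le> (\<Sum>g | g \<in> {G<..N} \<and> g dvd n. real n / real g)"
    if n: "n \<in> {n0..N}" for n
  proof -
    have "{i. i < n \<and> gcd (2 * i + 1) n > G} \<subseteq> (\<Union>g\<in>{g. g \<in> {G<..N} \<and> g dvd n}. {i. i < n \<and> g dvd 2 * i + 1})"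
    proof clarify
      fix i assume "i < n" "gcd (2 * i + 1) n > G"
      moreover have "gcd (2 * i + 1) n \<le> N" using n n0 by (auto intro: order_trans[OF gcd_le2_nat])
      ultimately show "i \<in> (\<Union>g\<in>{g. g \<in> {G<..N} \<and> g dvd n}. {i. i < n \<and> g dvd 2 * i + 1})"
        by (intro UN_I[of "gcd (2 * i + 1) n"]) auto
    qed
    then have "card {i. i < n \<and> gcd (2 * i + 1) n > G}
        \<le> card (\<Union>g\<in>{g. g \<in> {G<..N} \<and> g dvd n}. {i. i < n \<and> g dvd 2 * i + 1})"
      by (intro card_mono) auto
    also have "\<dots> \<le> (\<Sum>g | g \<in> {G<..N} \<and> g dvd n. card {i. i < n \<and> g dvd 2 * i + 1})"
      by (intro card_UN_le) auto
    also have "\<dots> \<le> (\<Sum>g | g \<in> {G<..N} \<and> g dvd n. n div g)"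
      by (intro sum_mono card_dvd_odd_le) auto
    finally have "real (card {i. i < n \<and> gcd (2 * i + 1) n > G})
        \<le> real (\<Sum>g | g \<in> {G<..N} \<and> g dvd n. n div g)" by (rule of_nat_mono)
    also have "\<dots> = (\<Sum>g | g \<in> {G<..N} \<and> g dvd n. real n / real g)"
      unfolding of_nat_sum by (intro sum.cong) (auto simp: real_of_nat_div)
    finally show ?thesis .
  qed
  have "indices n0 N - low G = (SIGMA n:{n0..N}. {i. i < n \<and> gcd (2 * i + 1) n > G})"
    by (auto simp: indices_def low_def)
  then have "(\<Sum>p\<in>indices n0 N - low G. measure lborel (windowp c p))
      = (\<Sum>n=n0..N. \<Sum>i | i < n \<and> gcd (2 * i + 1) n > G. measure lborel (window c n i))"
    by (simp only:) (subst sum.Sigma, auto simp: case_prod_unfold)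
  also have "\<dots> = (\<Sum>n=n0..N. real (card {i. i < n \<and> gcd (2 * i + 1) n > G}) * (c / (real n)\<^sup>2))"
    using c n0 by (intro sum.cong) (auto simp: measure_window)
  also have "\<dots> \<le> (\<Sum>n=n0..N. (\<Sum>g | g \<in> {G<..N} \<and> g dvd n. real n / real g) * (c / (real n)\<^sup>2))"
    using c by (intro sum_mono mult_right_mono card) auto
  also have "\<dots> = (\<Sum>n=n0..N. \<Sum>g | g \<in> {G<..N} \<and> g dvd n. c / real g * (1 / real n))"
    unfolding sum_distrib_right using n0
    by (intro sum.cong refl) (auto simp: field_simps power2_eq_square)
  also have "\<dots> \<le> (\<Sum>n=1..N. \<Sum>g | g \<in> {G<..N} \<and> g dvd n. c / real g * (1 / real n))"
    using n0 c by (intro sum_mono2) (auto intro!: sum_nonneg)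
  also have "\<dots> = (\<Sum>g\<in>{G<..N}. \<Sum>n | n \<in> {1..N} \<and> g dvd n. c / real g * (1 / real n))"
    by (rule sum.swap_restrict) auto
  also have "\<dots> = (\<Sum>g\<in>{G<..N}. c / real g * (\<Sum>n | n \<in> {1..N} \<and> g dvd n. 1 / real n))"
    by (simp add: sum_distrib_left)
  also have "\<dots> \<le> (\<Sum>g\<in>{G<..N}. c / real g * (harm N / real g))"
    using c by (intro sum_mono mult_left_mono sum_inverse_multiples_le) auto
  also have "\<dots> = c * harm N * (\<Sum>g\<in>{G<..N}. 1 / (real g)\<^sup>2)"
    by (simp add: sum_distrib_left power2_eq_square)
  also have "\<dots> \<le> c * harm N * (1 / real G)"
    using c G by (intro mult_left_mono sum_inverse_squares_tail_le) (auto simp: harm_nonneg)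
  finally show ?thesis by simp
qed

section \<open>Second moments\<close>

lemma sum_symmetric_le:
  fixes f :: "'a \<Rightarrow> 'a \<Rightarrow> real" and r :: "'a \<Rightarrow> nat"
  assumes A: "finite A" and sym: "\<And>p q. f p q = f q p" and nonneg: "\<And>p q. f p q \<ge> 0"
  shows "(\<Sum>p\<in>A. \<Sum>q\<in>A. f p q) \<le> 2 * (\<Sum>p\<in>A. \<Sum>q | q \<in> A \<and> r q \<le> r p. f p q)"
proof -
  have "(\<Sum>p\<in>A. \<Sum>q\<in>A. f p q) \<le> (\<Sum>p\<in>A. (\<Sum>q | q \<in> A \<and> r q \<le> r p. f p q) + (\<Sum>q | q \<in> A \<and> r p \<le> r q. f p q))"
  proof (rule sum_mono)
    fix p
    have "A = {q \<in> A. r q \<le> r p} \<union> {q \<in> A. r p \<le> r q}" by auto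
    then have "(\<Sum>q\<in>A. f p q) = (\<Sum>q\<in>{q \<in> A. r q \<le> r p} \<union> {q \<in> A. r p \<le> r q}. f p q)" by simp
    also have "\<dots> \<le> (\<Sum>q | q \<in> A \<and> r q \<le> r p. f p q) + (\<Sum>q | q \<in> A \<and> r p \<le> r q. f p q)"
      using A nonneg by (subst sum.union_inter[symmetric]) (auto intro: sum_nonneg)
    finally show "(\<Sum>q\<in>A. f p q) \<le> (\<Sum>q | q \<in> A \<and> r q \<le> r p. f p q) + (\<Sum>q | q \<in> A \<and> r p \<le> r q. f p q)" .
  qed
  moreover have "(\<Sum>p\<in>A. \<Sum>q | q \<in> A \<and> r p \<le> r q. f p q) = (\<Sum>q\<in>A. \<Sum>p | p \<in> A \<and> r p \<le> r q. f q p)"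
    by (subst sum.swap_restrict) (auto simp: A sym)
  ultimately show ?thesis by (simp add: sum.distrib)
qed

text \<open>By symmetry the first window may be taken to have the larger denominator, and its length
  bounds the overlap. Membership in \<open>low G\<close> and \<open>card_same_point_le\<close> leave
  at most \<open>G\<close> partners for it.\<close>

lemma same_point_overlap_sum_le:
  fixes N G :: nat
  assumes c: "c > 0" and n0: "n0 > 0"
  defines "A \<equiv> indices n0 N \<inter> low G"
  shows "(\<Sum>p\<in>A. \<Sum>q\<in>A. if half_oddp p = half_oddp q then measure lborel (windowp c p \<inter> windowp c q) else 0)
           \<le> 2 * real G * (\<Sum>n=n0..N. c / real n)"
proof -
  define f where "f = (\<lambda>p q. if half_oddp p = half_oddp q then measure lborel (windowp c p \<inter> windowp c q) else 0)"
  have A: "finite A" by (simp add: A_def)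
  have "(\<Sum>p\<in>A. \<Sum>q\<in>A. f p q) \<le> 2 * (\<Sum>p\<in>A. \<Sum>q | q \<in> A \<and> fst q \<le> fst p. f p q)"
    by (rule sum_symmetric_le) (auto simp: A f_def Int_commute)
  also have "(\<Sum>p\<in>A. \<Sum>q | q \<in> A \<and> fst q \<le> fst p. f p q) \<le> (\<Sum>p\<in>A. real G * measure lborel (windowp c p))"
  proof (rule sum_mono)
    fix p assume p: "p \<in> A"
    obtain n i where pni: "p = (n, i)" by force
    have n: "n > 0" "gcd (2 * i + 1) n \<le> G" using p n0 by (auto simp: A_def indices_def low_def pni)
    have sub: "{q \<in> A. fst q \<le> fst p \<and> half_oddp p = half_oddp q} \<subseteq> {(m, j). 0 < m \<and> m \<le> n \<and> j < m \<and> half_odd m j = half_odd n i}"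
      using n0 by (auto simp: A_def indices_def pni)
    have "card {q \<in> A. fst q \<le> fst p \<and> half_oddp p = half_oddp q} \<le> card {(m, j). 0 < m \<and> m \<le> n \<and> j < m \<and> half_odd m j = half_odd n i}"
      by (rule card_mono[OF _ sub]) (rule finite_subset[of _ "{..n} \<times> {..n}"], auto)
    also have "\<dots> \<le> G" using card_same_point_le[of n i] n by linarith
    finally have card: "real (card {q \<in> A. fst q \<le> fst p \<and> half_oddp p = half_oddp q}) \<le> real G" by simp
    have "(\<Sum>q | q \<in> A \<and> fst q \<le> fst p. f p q) = (\<Sum>q | q \<in> A \<and> fst q \<le> fst p \<and> half_oddp p = half_oddp q. f p q)"
      using A by (intro sum.mono_neutral_right) (auto simp: f_def)
    also have "\<dots> \<le> (\<Sum>q | q \<in> A \<and> fst q \<le> fst p \<and> half_oddp p = half_oddp q. measure lborel (windowp c p))"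
      unfolding f_def
      by (intro sum_mono) (auto intro!: measure_mono_fmeasurable window_fmeasurable simp: fmeasurableD)
    also have "\<dots> \<le> real G * measure lborel (windowp c p)"
      using card by (auto intro!: mult_right_mono)
    finally show "(\<Sum>q | q \<in> A \<and> fst q \<le> fst p. f p q) \<le> real G * measure lborel (windowp c p)" .
  qed
  also have "(\<Sum>p\<in>A. real G * measure lborel (windowp c p)) \<le> real G * (\<Sum>p\<in>indices n0 N. measure lborel (windowp c p))"
    unfolding sum_distrib_left[symmetric] by (intro mult_left_mono sum_mono2) (auto simp: A_def)
  also have "\<dots> = real G * (\<Sum>n=n0..N. c / real n)"
    by (subst sum_measure_window_indices) (use c n0 in auto)
  finally show ?thesis by (simp add: f_def)
qed

text \<open>Summed over all ordered pairs of denominators, the main terms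
  \<open>(c / n) * (c / m)\<close> factor into the square of the mean, which is what a variance
  estimate has to cancel.\<close>

lemma distinct_point_overlap_sum_le:
  assumes c: "c > 0" and n0: "n0 > 0"
  shows "(\<Sum>p\<in>indices n0 N. \<Sum>q\<in>indices n0 N. if half_oddp p \<noteq> half_oddp q then measure lborel (windowp c p \<inter> windowp c q) else 0)
           \<le> (\<Sum>n=n0..N. c / real n)\<^sup>2 + 16 * c\<^sup>2 * harm N"
proof -
  define ov where "ov = (\<lambda>n m. \<Sum>(i, j) | i < n \<and> j < m \<and> half_odd n i \<noteq> half_odd m j. measure lborel (window c n i \<inter> window c m j))"
  \<comment> \<open>The overlap bound is stated for \<open>m \<le> n\<close>;
    \<open>exm n m + exm m n\<close> covers both orders in one formula and merely doubles the
    diagonal.\<close>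
  define exm where "exm = (\<lambda>n m. if m \<le> n then excess c m n else 0)"
  have ov_sym: "ov n m = ov m n" for n m
    unfolding ov_def
    by (rule sum.reindex_bij_witness[of _ "\<lambda>(x, y). (y, x)" "\<lambda>(x, y). (y, x)"]) (auto simp: Int_commute)
  have ov_eq: "(\<Sum>i<n. \<Sum>j<m. if half_odd n i \<noteq> half_odd m j then measure lborel (window c n i \<inter> window c m j) else 0) = ov n m" for n m
    unfolding ov_def sum.cartesian_product by (rule sum.mono_neutral_cong_right) auto
  have ov: "ov n m \<le> (c / real n) * (c / real m) + (exm n m + exm m n)" if "n > 0" "m > 0" for n m
  proof (cases "m \<le> n")
    case True
    then have "excess c m n \<le> exm n m + exm m n"
      using excess_nonneg[OF c] by (auto simp: exm_def)
    then show ?thesis using distinct_overlap_sum_le[OF c that(2) True] unfolding ov_def by linarith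
  next
    case False
    then have "excess c n m = exm n m + exm m n" by (simp add: exm_def)
    then show ?thesis
      using distinct_overlap_sum_le[OF c that(1), of m] False ov_sym[of n m] mult.commute[of "c / real n" "c / real m"]
      unfolding ov_def by linarith
  qed
  have exm_sum: "(\<Sum>n=n0..N. \<Sum>m=n0..N. exm n m) \<le> 8 * c\<^sup>2 * harm N"
  proof -
    have "(\<Sum>n=n0..N. \<Sum>m=n0..N. exm n m) \<le> (\<Sum>n=1..N. \<Sum>m=1..N. exm n m)"
      unfolding sum.cartesian_product using n0 c
      by (intro sum_mono2) (auto simp: exm_def excess_nonneg split: if_splits)
    also have "\<dots> = (\<Sum>n=1..N. \<Sum>m=1..n. excess c m n)"
      by (intro sum.cong refl sum.mono_neutral_cong_right) (auto simp: exm_def)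
    also have "\<dots> \<le> 8 * c\<^sup>2 * harm N" by (rule sum_excess_le[OF c])
    finally show ?thesis .
  qed
  have "(\<Sum>p\<in>indices n0 N. \<Sum>q\<in>indices n0 N. if half_oddp p \<noteq> half_oddp q then measure lborel (windowp c p \<inter> windowp c q) else 0)
      = (\<Sum>n=n0..N. \<Sum>i<n. \<Sum>m=n0..N. \<Sum>j<m. if half_odd n i \<noteq> half_odd m j then measure lborel (window c n i \<inter> window c m j) else 0)"
    unfolding indices_def by (subst (1 2) sum.Sigma) (auto simp: case_prod_unfold)
  also have "\<dots> = (\<Sum>n=n0..N. \<Sum>m=n0..N. \<Sum>i<n. \<Sum>j<m. if half_odd n i \<noteq> half_odd m j then measure lborel (window c n i \<inter> window c m j) else 0)"
    by (intro sum.cong refl sum.swap)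
  also have "\<dots> = (\<Sum>n=n0..N. \<Sum>m=n0..N. ov n m)"
    by (simp only: ov_eq)
  also have "\<dots> \<le> (\<Sum>n=n0..N. \<Sum>m=n0..N. (c / real n) * (c / real m) + (exm n m + exm m n))"
    using n0 by (intro sum_mono ov) auto
  also have "\<dots> = (\<Sum>n=n0..N. c / real n)\<^sup>2 + ((\<Sum>n=n0..N. \<Sum>m=n0..N. exm n m) + (\<Sum>n=n0..N. \<Sum>m=n0..N. exm m n))"
    by (simp add: sum.distrib power2_eq_square sum_product)
  also have "(\<Sum>n=n0..N. \<Sum>m=n0..N. exm m n) = (\<Sum>n=n0..N. \<Sum>m=n0..N. exm n m)"
    by (rule sum.swap)
  finally show ?thesis using exm_sum by simp
qed

lemma second_moment_le:
  fixes N G :: nat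
  assumes c: "c > 0" and n0: "n0 > 0"
  defines "A \<equiv> indices n0 N \<inter> low G"
  shows "(\<Sum>p\<in>A. \<Sum>q\<in>A. measure lborel (windowp c p \<inter> windowp c q))
           \<le> (\<Sum>n=n0..N. c / real n)\<^sup>2 + 2 * real G * (\<Sum>n=n0..N. c / real n) + 16 * c\<^sup>2 * harm N"
proof -
  let ?m = "\<lambda>p q. measure lborel (windowp c p \<inter> windowp c q)"
  have "(\<Sum>p\<in>A. \<Sum>q\<in>A. ?m p q)
      = (\<Sum>p\<in>A. \<Sum>q\<in>A. if half_oddp p = half_oddp q then ?m p q else 0) + (\<Sum>p\<in>A. \<Sum>q\<in>A. if half_oddp p \<noteq> half_oddp q then ?m p q else 0)"
    unfolding sum.distrib[symmetric] by (intro sum.cong) auto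
  \<comment> \<open>For distinct points the nonnegative terms outside \<open>low G\<close> are put
    back, since only the full sum factors.\<close>
  also have "(\<Sum>p\<in>A. \<Sum>q\<in>A. if half_oddp p \<noteq> half_oddp q then ?m p q else 0)
      \<le> (\<Sum>p\<in>indices n0 N. \<Sum>q\<in>indices n0 N. if half_oddp p \<noteq> half_oddp q then ?m p q else 0)"
    by (rule order_trans[OF sum_mono sum_mono2], rule sum_mono2) (auto simp: A_def intro!: sum_nonneg)
  finally show ?thesis
    using same_point_overlap_sum_le[OF c n0, of N G] distinct_point_overlap_sum_le[OF c n0, of N]
    unfolding A_def by linarith
qed

section \<open>Almost everywhere convergence\<close>

text \<open>A Borel-Cantelli argument in integral form: the sum of the functions has finite
  integral, hence is finite almost everywhere, and the terms of a convergent series tend to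
  0.\<close>

lemma AE_tendsto_zero_of_summable_integral:
  fixes f :: "nat \<Rightarrow> 'a \<Rightarrow> real"
  assumes int: "\<And>k. integrable M (f k)" and nonneg: "\<And>k x. f k x \<ge> 0"
    and summable: "summable (\<lambda>k. \<integral>x. f k x \<partial>M)"
  shows "AE x in M. (\<lambda>k. f k x) \<longlonglongrightarrow> 0"
proof -
  have meas [measurable]: "\<And>k. f k \<in> borel_measurable M" using int by auto
  have "(\<integral>\<^sup>+x. (\<Sum>k. ennreal (f k x)) \<partial>M) = (\<Sum>k. \<integral>\<^sup>+x. ennreal (f k x) \<partial>M)"
    by (rule nn_integral_suminf) auto
  also have "\<dots> = (\<Sum>k. ennreal (\<integral>x. f k x \<partial>M))"
    by (intro suminf_cong nn_integral_eq_integral int) (auto simp: nonneg)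
  also have "\<dots> \<noteq> \<infinity>"
    using summable by (subst suminf_ennreal2) (auto intro!: integral_nonneg_AE simp: nonneg)
  finally have "AE x in M. (\<Sum>k. ennreal (f k x)) \<noteq> \<infinity>"
    by (intro nn_integral_PInf_AE) auto
  then show ?thesis
  proof eventually_elim
    case (elim x)
    then have "summable (\<lambda>k. f k x)"
      using nonneg by (intro summable_suminf_not_top) auto
    then show ?case by (rule summable_LIMSEQ_zero)
  qed
qed

section \<open>Hit counts and their limit along a sparse subsequence\<close>

definition hits :: "real \<Rightarrow> (nat \<times> nat) set \<Rightarrow> real \<Rightarrow> real" where
  "hits c A x = (\<Sum>p\<in>A. indicator (windowp c p) x)"

lemma integrable_window: "integrable lborel (indicator (window c n i) :: real \<Rightarrow> real)"
  using window_fmeasurable[of c n i] by (intro integrable_real_indicator) (auto simp: fmeasurable_def)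

lemma integrable_window_Int:
  "integrable lborel (indicator (window c n i \<inter> window c m j) :: real \<Rightarrow> real)"
proof -
  have "window c n i \<inter> window c m j \<in> fmeasurable lborel"
    by (intro fmeasurable.Int window_fmeasurable)
  then show ?thesis
    by (intro integrable_real_indicator) (auto simp: fmeasurable_def)
qed

lemma integrable_hits: "integrable lborel (hits c A)"
  unfolding hits_def by (intro Bochner_Integration.integrable_sum integrable_window)

lemma integral_hits: "(\<integral>x. hits c A x \<partial>lborel) = (\<Sum>p\<in>A. measure lborel (windowp c p))"
  unfolding hits_def by (subst Bochner_Integration.integral_sum) (auto simp: integrable_window)

lemma hits_nonneg: "hits c A x \<ge> 0"
  by (simp add: hits_def sum_nonneg)

lemma hits_square: "(hits c A x)\<^sup>2 = (\<Sum>p\<in>A. \<Sum>q\<in>A. indicator (windowp c p \<inter> windowp c q) x)"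
  by (simp add: hits_def power2_eq_square sum_product indicator_inter_arith)

lemma integrable_hits_square: "integrable lborel (\<lambda>x. (hits c A x)\<^sup>2)"
  unfolding hits_square by (intro Bochner_Integration.integrable_sum integrable_window_Int)

lemma integral_hits_square:
  "(\<integral>x. (hits c A x)\<^sup>2 \<partial>lborel) = (\<Sum>p\<in>A. \<Sum>q\<in>A. measure lborel (windowp c p \<inter> windowp c q))"
  unfolding hits_square
  by (simp add: Bochner_Integration.integral_sum Bochner_Integration.integrable_sum integrable_window_Int)

lemma window_subset_unit:
  assumes "c > 0" "2 * c \<le> real n" "i < n"
  shows "window c n i \<subseteq> {0..<1}"
proof -
  have n: "real n > 0" using assms by simp
  have "c / (real n)\<^sup>2 \<le> 1 / (2 * real n)"
    using assms n by (simp add: field_simps power2_eq_square)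
  also have "\<dots> \<le> half_odd n i" using n by (simp add: half_odd_def field_simps)
  finally have "0 \<le> half_odd n i - c / (real n)\<^sup>2" by simp
  moreover have "half_odd n i \<le> 1"
  proof -
    have "2 * real i + 1 \<le> 2 * real n" using assms(3) by linarith
    then show ?thesis using n by (simp add: half_odd_def field_simps)
  qed
  ultimately show ?thesis by (auto simp: window_def)
qed

text \<open>The counts are centred at the mean \<open>M\<close> of all hits, not at that of the low
  ones. After expanding the square the terms in \<open>M^2\<close> cancel, and the missing mean of
  the discarded windows costs the last summand.\<close>

lemma variance_low_hits_le:
  fixes N G :: nat
  assumes c: "c > 0" and n0: "n0 > 0" "2 * c \<le> real n0" and G: "G \<ge> 1"
  defines "A \<equiv> indices n0 N \<inter> low G" and "M \<equiv> \<Sum>n=n0..N. c / real n"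
  shows "integrable lborel (\<lambda>x. (hits c A x - M)\<^sup>2 * indicator {0..<1} x)" (is "integrable _ ?V")
    and "(\<integral>x. (hits c A x - M)\<^sup>2 * indicator {0..<1} x \<partial>lborel)
           \<le> 2 * real G * M + 16 * c\<^sup>2 * harm N + 2 * M * (c * harm N / real G)"
proof -
  \<comment> \<open>As \<open>2 * c \<le> n0\<close>, every window lies in the unit interval, so
    after expansion the indicator matters only for the constant term.\<close>
  have outside: "hits c A x = 0" if "x \<notin> {0..<1}" for x
    unfolding hits_def
  proof (rule sum.neutral, clarify)
    fix n i assume "(n, i) \<in> A"
    then have "window c n i \<subseteq> {0..<1}"
      using c n0 by (intro window_subset_unit) (auto simp: A_def indices_def)
    then show "indicator (window c (fst (n, i)) (snd (n, i))) x = (0::real)"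
      using that by (auto simp: indicator_def)
  qed
  have V: "?V = (\<lambda>x. (hits c A x)\<^sup>2 - 2 * M * hits c A x + M\<^sup>2 * indicator {0..<1} x)"
    using outside by (auto simp: fun_eq_iff indicator_def power2_eq_square algebra_simps)
  have unit: "integrable lborel (\<lambda>x. M\<^sup>2 * indicator {0..<1::real} x)"
    by (intro integrable_mult_right integrable_real_indicator) auto
  show "integrable lborel ?V"
    unfolding V using unit
    by (intro Bochner_Integration.integrable_add Bochner_Integration.integrable_diff integrable_mult_right
        integrable_hits integrable_hits_square) auto
  have "(\<integral>x. ?V x \<partial>lborel) = (\<integral>x. (hits c A x)\<^sup>2 \<partial>lborel) - 2 * M * (\<integral>x. hits c A x \<partial>lborel) + M\<^sup>2"
    unfolding V using unit
    by (simp add: Bochner_Integration.integral_add Bochner_Integration.integral_diff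
        integrable_hits integrable_hits_square)
  moreover have "(\<integral>x. (hits c A x)\<^sup>2 \<partial>lborel) \<le> M\<^sup>2 + 2 * real G * M + 16 * c\<^sup>2 * harm N"
    unfolding integral_hits_square A_def M_def by (rule second_moment_le) (use c n0 in auto)
  moreover have "M - c * harm N / real G \<le> (\<integral>x. hits c A x \<partial>lborel)"
  proof -
    have "M = (\<Sum>p\<in>indices n0 N. measure lborel (windowp c p))"
      unfolding M_def by (rule sum_measure_window_indices[symmetric]) (use c n0 in auto)
    also have "\<dots> = (\<Sum>p\<in>A. measure lborel (windowp c p)) + (\<Sum>p\<in>indices n0 N - low G. measure lborel (windowp c p))"
      unfolding A_def by (rule sum.Int_Diff) simp
    finally show ?thesis
      using sum_measure_window_high_le[OF c n0(1) G, of N] unfolding integral_hits by linarith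
  qed
  then have "2 * M * (M - c * harm N / real G) \<le> 2 * M * (\<integral>x. hits c A x \<partial>lborel)"
    using c by (intro mult_left_mono) (auto simp: M_def intro!: sum_nonneg)
  ultimately show "(\<integral>x. ?V x \<partial>lborel) \<le> 2 * real G * M + 16 * c\<^sup>2 * harm N + 2 * M * (c * harm N / real G)"
    by (simp add: power2_eq_square algebra_simps)
qed


lemma harm_power2_le: "k \<ge> 1 \<Longrightarrow> harm (2 ^ (k ^ 4)) \<le> 2 * real k ^ 4"
proof -
  assume k: "k \<ge> 1"
  have "harm (2 ^ (k ^ 4)) - ln (real (2 ^ (k ^ 4))) \<le> harm 1 - ln (real 1)"
    using decseqD[OF decseq_harm_diff_ln, of 0 "2 ^ (k ^ 4) - 1"] by simp
  then have "harm (2 ^ (k ^ 4)) \<le> 1 + real k ^ 4 * ln 2"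
    by (simp add: ln_realpow harm_expand)
  also have "\<dots> \<le> real k ^ 4 + real k ^ 4 * 1"
    using k ln2_le_25_over_36 by (intro add_mono mult_left_mono) auto
  finally show ?thesis by simp
qed

lemma AE_hits_subsequence:
  assumes c: "c > 0" and n0: "n0 > 0" "2 * c \<le> real n0"
  shows "AE x in lborel. x \<in> {0..<1} \<longrightarrow>
           (\<lambda>k. hits c (indices n0 (2 ^ (k ^ 4))) x / real k ^ 4) \<longlonglongrightarrow> c * ln 2"
proof -
  define N where "N = (\<lambda>k::nat. 2 ^ (k ^ 4) :: nat)"
  \<comment> \<open>The mean has order \<open>k^4\<close>, and the variance bound contains terms of
    order \<open>G * k^4\<close> and \<open>k^8 / G\<close>; \<open>G = k^2\<close> balances them at
    \<open>k^6\<close>. Relative to \<open>k^8\<close> this is the summable \<open>1 / k^2\<close>,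
    which is also the relative size of the discarded mean. The maximum ensures
    \<open>G \<ge> 1\<close> at \<open>k = 0\<close>.\<close>
  define G where "G = (\<lambda>k::nat. max 1 (k ^ 2))"
  define M where "M = (\<lambda>k. \<Sum>n=n0..N k. c / real n)"
  define A where "A = (\<lambda>k. indices n0 (N k) \<inter> low (G k))"
  define B where "B = (\<lambda>k. indices n0 (N k) - low (G k))"
  have G: "G k \<ge> 1" for k by (simp add: G_def)
  have M0: "M k \<ge> 0" for k using c by (auto simp: M_def intro!: sum_nonneg)
  have Mharm: "M k \<le> c * harm (N k)" for k
  proof -
    have "M k \<le> (\<Sum>n=1..N k. c / real n)"
      unfolding M_def using c n0 by (intro sum_mono2) auto
    then show ?thesis by (simp add: harm_def sum_distrib_left divide_inverse)
  qed
  have H: "harm (N k) \<le> 2 * real k ^ 4" if "k \<ge> 1" for k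
    using harm_power2_le[OF that] by (simp add: N_def)
  have H0: "harm (N k) \<ge> (0::real)" for k by (rule harm_nonneg)
  have M2: "M k \<le> c * (2 * real k ^ 4)" if "k \<ge> 1" for k
    using Mharm[of k] mult_left_mono[OF H[OF that], of c] c by linarith
  have inv_sq: "summable (\<lambda>k. C * (1 / real k ^ 2))" for C :: real
    using inverse_power_summable[of 2, where ?'a = real]
    by (intro summable_mult) (simp add: inverse_eq_divide)
  have "AE x in lborel. (\<lambda>k. (hits c (A k) x - M k)\<^sup>2 * indicator {0..<1} x / real k ^ 8) \<longlonglongrightarrow> 0"
  proof (rule AE_tendsto_zero_of_summable_integral)
    fix k show "integrable lborel (\<lambda>x. (hits c (A k) x - M k)\<^sup>2 * indicator {0..<1} x / real k ^ 8)"
      using variance_low_hits_le(1)[OF c n0 G[of k], of "N k"] unfolding A_def M_def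
      by (rule integrable_divide)
  next
    show "summable (\<lambda>k. \<integral>x. (hits c (A k) x - M k)\<^sup>2 * indicator {0..<1} x / real k ^ 8 \<partial>lborel)"
    proof (rule summable_comparison_test'[OF inv_sq])
      fix k :: nat assume k: "k \<ge> 1"
      define I where "I = (\<integral>x. (hits c (A k) x - M k)\<^sup>2 * indicator {0..<1} x \<partial>lborel)"
      have I0: "I \<ge> 0" unfolding I_def by (rule integral_nonneg_AE) auto
      have k4: "real k ^ 4 = real k ^ 2 * real k ^ 2" and k6: "real k ^ 6 = real k ^ 2 * real k ^ 4"
        by (simp_all add: power_add[symmetric])
      have Gk: "real (G k) = real k ^ 2" using k by (simp add: G_def max_def)
      have "I \<le> 2 * real (G k) * M k + 16 * c\<^sup>2 * harm (N k) + 2 * M k * (c * harm (N k) / real (G k))"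
        unfolding I_def A_def M_def by (rule variance_low_hits_le(2)[OF c n0 G])
      also have "\<dots> \<le> 2 * real k ^ 2 * (c * (2 * real k ^ 4)) + 16 * c\<^sup>2 * (2 * real k ^ 4)
          + 2 * (c * (2 * real k ^ 4)) * (c * (2 * real k ^ 4) / real k ^ 2)"
        unfolding Gk using c M0 M2[OF k] H[OF k] H0
        by (intro add_mono mult_mono mult_left_mono divide_right_mono) auto
      also have "\<dots> \<le> 4 * c * real k ^ 6 + 32 * c\<^sup>2 * real k ^ 6 + 8 * c\<^sup>2 * real k ^ 6"
      proof (intro add_mono)
        show "2 * real k ^ 2 * (c * (2 * real k ^ 4)) \<le> 4 * c * real k ^ 6"
          unfolding k6 by (rule eq_refl, algebra)
        show "16 * c\<^sup>2 * (2 * real k ^ 4) \<le> 32 * c\<^sup>2 * real k ^ 6"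
          using power_increasing[of 4 6 "real k"] k by (simp add: mult_left_mono)
        show "2 * (c * (2 * real k ^ 4)) * (c * (2 * real k ^ 4) / real k ^ 2) \<le> 8 * c\<^sup>2 * real k ^ 6"
          unfolding k6 k4 using k by (simp add: field_simps power2_eq_square)
      qed
      finally have "I \<le> (4 * c + 40 * c\<^sup>2) * real k ^ 6" by (simp add: algebra_simps)
      then have "I / real k ^ 8 \<le> (4 * c + 40 * c\<^sup>2) * real k ^ 6 / real k ^ 8"
        by (intro divide_right_mono) auto
      also have "\<dots> = (4 * c + 40 * c\<^sup>2) * (1 / real k ^ 2)"
        using k by (simp add: field_simps power_add[symmetric])
      finally show "norm (\<integral>x. (hits c (A k) x - M k)\<^sup>2 * indicator {0..<1} x / real k ^ 8 \<partial>lborel)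
          \<le> (4 * c + 40 * c\<^sup>2) * (1 / real k ^ 2)"
        using I0 by (simp add: I_def)
    qed
  qed auto
  moreover have "AE x in lborel. (\<lambda>k. hits c (B k) x / real k ^ 4) \<longlonglongrightarrow> 0"
  proof (rule AE_tendsto_zero_of_summable_integral)
    show "integrable lborel (\<lambda>x. hits c (B k) x / real k ^ 4)" for k
      by (intro integrable_divide integrable_hits)
    show "summable (\<lambda>k. \<integral>x. hits c (B k) x / real k ^ 4 \<partial>lborel)"
    proof (rule summable_comparison_test'[OF inv_sq])
      fix k :: nat assume k: "k \<ge> 1"
      have Gk: "real (G k) = real k ^ 2" using k by (simp add: G_def max_def)
      have "(\<integral>x. hits c (B k) x \<partial>lborel) \<le> c * harm (N k) / real (G k)"
        unfolding integral_hits B_def by (rule sum_measure_window_high_le[OF c n0(1) G])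
      also have "\<dots> \<le> c * (2 * real k ^ 4) / real k ^ 2"
        unfolding Gk using c H[OF k] by (intro divide_right_mono mult_left_mono) auto
      finally have "(\<integral>x. hits c (B k) x \<partial>lborel) / real k ^ 4 \<le> c * (2 * real k ^ 4) / real k ^ 2 / real k ^ 4"
        by (intro divide_right_mono) auto
      also have "\<dots> = 2 * c * (1 / real k ^ 2)" using k by (simp add: field_simps)
      finally show "norm (\<integral>x. hits c (B k) x / real k ^ 4 \<partial>lborel) \<le> 2 * c * (1 / real k ^ 2)"
        by (simp add: integral_nonneg_AE hits_nonneg)
    qed
  qed (auto simp: hits_nonneg)
  ultimately show ?thesis
  proof eventually_elim
    case (elim x)
    show ?case
    proof
      assume x: "x \<in> {0..<1}"
      have "((hits c (A k) x - M k) / real k ^ 4)\<^sup>2 = (hits c (A k) x - M k)\<^sup>2 * indicator {0..<1} x / real k ^ 8" for k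
        using x by (simp add: power_divide power_mult[symmetric])
      then have "(\<lambda>k. ((hits c (A k) x - M k) / real k ^ 4)\<^sup>2) \<longlonglongrightarrow> 0" using elim(1) by simp
      then have "(\<lambda>k. \<bar>(hits c (A k) x - M k) / real k ^ 4\<bar>) \<longlonglongrightarrow> 0"
        using tendsto_real_sqrt by fastforce
      then have "(\<lambda>k. (hits c (A k) x - M k) / real k ^ 4) \<longlonglongrightarrow> 0"
        by (rule tendsto_rabs_zero_cancel)
      moreover have "(\<lambda>k. M k / real k ^ 4) \<longlonglongrightarrow> c * ln 2"
      proof -
        \<comment> \<open>The harmonic terms below \<open>n0\<close> form a constant, so
          \<open>M k = c * harm (N k) - K\<close>, and \<open>ln (N k) = k^4 * ln 2\<close> supplies
          the limit.\<close>
        define K where "K = (\<Sum>n=1..<n0. c / real n)"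
        have "k \<le> N k" for k
        proof -
          have "k \<le> k ^ 4" by (cases "k = 0") (auto intro: self_le_power)
          also have "\<dots> \<le> N k" unfolding N_def by (rule less_imp_le[OF less_exp])
          finally show ?thesis .
        qed
        then have "filterlim N at_top at_top"
          by (intro filterlim_at_top_mono[OF filterlim_ident]) (auto intro: always_eventually)
        then have "(\<lambda>k. harm (N k) - ln (real (N k))) \<longlonglongrightarrow> euler_mascheroni"
          using filterlim_compose[OF euler_mascheroni_LIMSEQ] by auto
        moreover have inv: "(\<lambda>k. 1 / real k ^ 4) \<longlonglongrightarrow> 0"
          by (intro tendsto_divide_0[OF tendsto_const] filterlim_at_top_imp_at_infinity filterlim_pow_at_top filterlim_real_sequentially) auto
        ultimately have "(\<lambda>k. c * ((harm (N k) - ln (real (N k))) * (1 / real k ^ 4)) + c * ln 2 - K * (1 / real k ^ 4))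
            \<longlonglongrightarrow> c * (euler_mascheroni * 0) + c * ln 2 - K * 0"
          by (intro tendsto_intros)
        moreover have "eventually (\<lambda>k. c * ((harm (N k) - ln (real (N k))) * (1 / real k ^ 4)) + c * ln 2 - K * (1 / real k ^ 4)
            = M k / real k ^ 4) at_top"
          using eventually_gt_at_top[of 0] filterlim_at_top[THEN iffD1, OF \<open>filterlim N at_top at_top\<close>, rule_format, of n0]
        proof eventually_elim
          case (elim k)
          have "{1..N k} = {1..<n0} \<union> {n0..N k}" using elim n0 by auto
          then have "(\<Sum>n=1..N k. c / real n) = K + M k"
            unfolding K_def M_def by (simp only:) (rule sum.union_disjoint, auto)
          then have "M k = c * harm (N k) - K"
            by (simp add: harm_def sum_distrib_left divide_inverse)
          moreover have "ln (real (N k)) = real k ^ 4 * ln 2"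
            by (simp add: N_def ln_realpow)
          ultimately show ?case using elim by (simp add: field_simps)
        qed
        ultimately show ?thesis by (simp add: filterlim_cong)
      qed
      ultimately have "(\<lambda>k. (hits c (A k) x - M k) / real k ^ 4 + M k / real k ^ 4 + hits c (B k) x / real k ^ 4) \<longlonglongrightarrow> 0 + c * ln 2 + 0"
        using elim(2) by (intro tendsto_add)
      moreover have "(hits c (A k) x - M k) / real k ^ 4 + M k / real k ^ 4 + hits c (B k) x / real k ^ 4
          = hits c (indices n0 (2 ^ (k ^ 4))) x / real k ^ 4" for k
      proof -
        have "hits c (indices n0 (N k)) x = hits c (A k) x + hits c (B k) x"
          unfolding hits_def A_def B_def by (rule sum.Int_Diff) simp
        then show ?thesis by (simp add: N_def add_divide_distrib[symmetric])
      qed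
      ultimately show "(\<lambda>k. hits c (indices n0 (2 ^ (k ^ 4))) x / real k ^ 4) \<longlonglongrightarrow> c * ln 2" by simp
    qed
  qed
qed

section \<open>From the subsequence to all N, and from the unit interval to the real line\<close>

definition near_half :: "real \<Rightarrow> nat \<Rightarrow> real \<Rightarrow> bool" where
  "near_half c n x \<longleftrightarrow> (\<exists>k::int. 0 < of_int k + 1/2 - real n * x \<and> of_int k + 1/2 - real n * x \<le> c / real n)"

text \<open>Monotonicity traps \<open>F N\<close> between its values at consecutive terms of the
  subsequence. The logarithms of these terms have ratio \<open>((k + 1) / k)^4\<close>, which tends
  to 1, so nothing is lost in the limit.\<close>

lemma tendsto_div_ln_of_subsequence:
  fixes F :: "nat \<Rightarrow> real"
  assumes mono: "mono F" and nonneg: "\<And>N. F N \<ge> 0"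
    and lim: "(\<lambda>k. F (2 ^ (k ^ 4)) / real k ^ 4) \<longlonglongrightarrow> l"
  shows "(\<lambda>N. F N / ln (real N)) \<longlonglongrightarrow> l / ln 2"
proof -
  \<comment> \<open>For \<open>N \<ge> 1\<close> this is the largest \<open>k\<close> with
    \<open>2 ^ (k ^ 4) \<le> N\<close>.\<close>
  define \<kappa> where "\<kappa> = (\<lambda>N::nat. LEAST k. N < 2 ^ (Suc k ^ 4))"
  have ex: "\<exists>k. N < 2 ^ (Suc k ^ 4)" for N :: nat
  proof
    have "N < 2 ^ N" by (rule less_exp)
    also have "\<dots> \<le> 2 ^ (Suc N ^ 4)"
      using self_le_power[of "Suc N" 4] by (intro power_increasing) auto
    finally show "N < 2 ^ (Suc N ^ 4)" .
  qed
  have upper: "N < 2 ^ (Suc (\<kappa> N) ^ 4)" for N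
    unfolding \<kappa>_def by (rule LeastI_ex[OF ex])
  have lower: "2 ^ (\<kappa> N ^ 4) \<le> N" if "N \<ge> 1" for N
  proof (cases "\<kappa> N")
    case (Suc k)
    then have "\<not> N < 2 ^ (Suc k ^ 4)" unfolding \<kappa>_def by (intro not_less_Least) simp
    then show ?thesis by (simp add: Suc)
  qed (use that in simp)
  have \<kappa>_top: "filterlim \<kappa> at_top at_top"
  proof (subst filterlim_at_top, intro allI)
    fix K
    show "eventually (\<lambda>N. \<kappa> N \<ge> K) at_top"
      using eventually_ge_at_top[of "2 ^ (K ^ 4)"]
    proof eventually_elim
      case (elim N)
      show ?case
      proof (rule ccontr)
        assume "\<not> K \<le> \<kappa> N"
        then have "(2::nat) ^ (Suc (\<kappa> N) ^ 4) \<le> 2 ^ (K ^ 4)"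
          by (intro power_increasing power_mono) auto
        with upper[of N] elim show False by linarith
      qed
    qed
  qed
  have ratio: "(\<lambda>k. (real (Suc k) / real k) ^ 4) \<longlonglongrightarrow> 1"
    using tendsto_power[OF LIMSEQ_Suc_n_over_n, of 4] by simp
  have ratio': "(\<lambda>k. (real k / real (Suc k)) ^ 4) \<longlonglongrightarrow> 1"
    using tendsto_power[OF LIMSEQ_n_over_Suc_n, of 4] by simp
  have up: "(\<lambda>k. F (2 ^ (Suc k ^ 4)) / real (Suc k) ^ 4 * (real (Suc k) / real k) ^ 4 / ln 2) \<longlonglongrightarrow> l * 1 / ln 2"
    using LIMSEQ_Suc[OF lim] ratio by (intro tendsto_intros) auto
  have low: "(\<lambda>k. F (2 ^ (k ^ 4)) / real k ^ 4 * (real k / real (Suc k)) ^ 4 / ln 2) \<longlonglongrightarrow> l * 1 / ln 2"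
    using lim ratio' by (intro tendsto_intros) auto
  have ev: "eventually (\<lambda>N. \<kappa> N \<ge> 1 \<and> N \<ge> 2) at_top"
    using \<kappa>_top[unfolded filterlim_at_top, rule_format, of 1] eventually_ge_at_top[of 2]
    by eventually_elim auto
  have "(\<lambda>N. F N / ln (real N)) \<longlonglongrightarrow> l * 1 / ln 2"
  proof (rule tendsto_sandwich[OF _ _ filterlim_compose[OF low \<kappa>_top] filterlim_compose[OF up \<kappa>_top]])
    show "\<forall>\<^sub>F N in at_top. F (2 ^ (\<kappa> N ^ 4)) / real (\<kappa> N) ^ 4 * (real (\<kappa> N) / real (Suc (\<kappa> N))) ^ 4 / ln 2 \<le> F N / ln (real N)"
      using ev
    proof eventually_elim
      case (elim N)
      have "ln (real N) \<le> ln (real (2 ^ (Suc (\<kappa> N) ^ 4)))"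
        using upper[of N] elim by (intro ln_mono) (auto simp del: power_Suc of_nat_power intro: less_imp_le of_nat_mono)
      also have "\<dots> = real (Suc (\<kappa> N)) ^ 4 * ln 2" by (simp add: ln_realpow del: of_nat_Suc)
      finally have "F (2 ^ (\<kappa> N ^ 4)) / (real (Suc (\<kappa> N)) ^ 4 * ln 2) \<le> F N / ln (real N)"
        using elim lower[of N] nonneg monoD[OF mono] by (intro frac_le) auto
      moreover have "F (2 ^ (\<kappa> N ^ 4)) / real (\<kappa> N) ^ 4 * (real (\<kappa> N) / real (Suc (\<kappa> N))) ^ 4 / ln 2
          = F (2 ^ (\<kappa> N ^ 4)) / (real (Suc (\<kappa> N)) ^ 4 * ln 2)"
        using elim by (simp add: power_divide del: of_nat_Suc)
      ultimately show ?case by linarith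
    qed
    show "\<forall>\<^sub>F N in at_top. F N / ln (real N) \<le> F (2 ^ (Suc (\<kappa> N) ^ 4)) / real (Suc (\<kappa> N)) ^ 4 * (real (Suc (\<kappa> N)) / real (\<kappa> N)) ^ 4 / ln 2"
      using ev
    proof eventually_elim
      case (elim N)
      have "real (\<kappa> N) ^ 4 * ln 2 = ln (real (2 ^ (\<kappa> N ^ 4)))" by (simp add: ln_realpow)
      also have "\<dots> \<le> ln (real N)"
        using lower[of N] elim by (intro ln_mono) (auto simp del: of_nat_power intro: of_nat_mono)
      finally have "F N / ln (real N) \<le> F (2 ^ (Suc (\<kappa> N) ^ 4)) / (real (\<kappa> N) ^ 4 * ln 2)"
        using elim upper[of N] nonneg monoD[OF mono, of N "2 ^ (Suc (\<kappa> N) ^ 4)"] by (intro frac_le) auto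
      moreover have "F (2 ^ (Suc (\<kappa> N) ^ 4)) / real (Suc (\<kappa> N)) ^ 4 * (real (Suc (\<kappa> N)) / real (\<kappa> N)) ^ 4 / ln 2
          = F (2 ^ (Suc (\<kappa> N) ^ 4)) / (real (\<kappa> N) ^ 4 * ln 2)"
        using elim by (simp add: power_divide del: of_nat_Suc)
      ultimately show ?case by linarith
    qed
  qed
  then show ?thesis by simp
qed

text \<open>Since \<open>c / n < 1/2\<close>, the integer in \<open>near_half\<close> is unique, and
  for \<open>x\<close> in the unit interval it lies between 0 and \<open>n - 1\<close>. So at most
  one window of denominator \<open>n\<close> contains \<open>x\<close>, and the sum is a truth
  value.\<close>

lemma sum_indicator_window:
  assumes c: "c > 0" and n: "2 * c < real n" and x: "x \<in> {0..<1}"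
  shows "(\<Sum>i<n. indicator (window c n i) x) = (of_bool (near_half c n x) :: real)"
proof -
  have n0: "real n > 0" using c n by simp
  have half: "c / real n < 1/2" using n n0 by (simp add: field_simps)
  have mem: "x \<in> window c n i \<longleftrightarrow> 0 < real i + 1/2 - real n * x \<and> real i + 1/2 - real n * x \<le> c / real n" for i
  proof -
    have "half_odd n i - x = (real i + 1/2 - real n * x) / real n"
      using n0 by (simp add: half_odd_def field_simps)
    moreover have "c / (real n)\<^sup>2 = c / real n / real n" by (simp add: power2_eq_square)
    moreover have "x \<in> window c n i \<longleftrightarrow> 0 < half_odd n i - x \<and> half_odd n i - x \<le> c / (real n)\<^sup>2"
      by (auto simp: window_def)
    ultimately have "x \<in> window c n i \<longleftrightarrow> 0 < (real i + 1/2 - real n * x) / real n \<and>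
        (real i + 1/2 - real n * x) / real n \<le> c / real n / real n" by (simp only:)
    then show ?thesis using n0 by (simp only: zero_less_divide_iff divide_le_cancel) auto
  qed
  show ?thesis
  proof (cases "near_half c n x")
    case True
    then obtain k :: int where k: "0 < of_int k + 1/2 - real n * x" "of_int k + 1/2 - real n * x \<le> c / real n"
      by (auto simp: near_half_def)
    have "0 \<le> real n * x" "real n * x \<le> real n"
      using x n0 by auto
    then have "-1/2 < real_of_int k" "real_of_int k < real n"
      using k half by linarith+
    then have "0 \<le> k" "k < int n" by linarith+
    then obtain i where i: "k = int i" "i < n" by (metis nonneg_int_cases of_nat_less_iff)
    have iff: "x \<in> window c n j \<longleftrightarrow> j = i" for j
    proof
      assume "x \<in> window c n j"
      then have "real j < real i + 1" "real i < real j + 1"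
        using k half unfolding mem i(1) of_int_of_nat_eq by linarith+
      then show "j = i" by linarith
    qed (use k in \<open>simp add: mem i(1)\<close>)
    have "(\<Sum>j<n. indicator (window c n j) x) = (\<Sum>j<n. if j = i then 1 else 0 :: real)"
      by (intro sum.cong) (auto simp: indicator_def iff)
    then show ?thesis using True i by simp
  next
    case False
    then have "x \<notin> window c n i" for i
      unfolding mem near_half_def by (metis of_int_of_nat_eq)
    then show ?thesis using False by simp
  qed
qed

lemma hits_eq_card:
  assumes c: "c > 0" and n0: "2 * c < real n0" and x: "x \<in> {0..<1}"
  shows "hits c (indices n0 N) x = real (card {n \<in> {n0..N}. near_half c n x})"
proof -
  have "hits c (indices n0 N) x = (\<Sum>n=n0..N. \<Sum>i<n. indicator (window c n i) x)"
    unfolding hits_def indices_def by (subst sum.Sigma) (auto simp: case_prod_unfold)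
  also have "\<dots> = (\<Sum>n=n0..N. of_bool (near_half c n x))"
    using n0 by (intro sum.cong refl sum_indicator_window[OF c _ x]) auto
  also have "\<dots> = real (card {n \<in> {n0..N}. near_half c n x})"
    by (simp add: of_bool_def sum.If_cases Int_def)
  finally show ?thesis .
qed

lemma tendsto_div_ln_bounded_change:
  fixes f g :: "nat \<Rightarrow> real"
  assumes "(\<lambda>N. f N / ln (real N)) \<longlonglongrightarrow> l" "\<And>N. \<bar>g N - f N\<bar> \<le> C"
  shows "(\<lambda>N. g N / ln (real N)) \<longlonglongrightarrow> l"
proof -
  have ln: "filterlim (\<lambda>N. ln (real N)) at_top sequentially"
    by (intro filterlim_compose[OF ln_at_top] filterlim_real_sequentially)
  have "(\<lambda>N. C / ln (real N)) \<longlonglongrightarrow> 0"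
    by (intro tendsto_divide_0[OF tendsto_const] filterlim_at_top_imp_at_infinity ln)
  moreover have "eventually (\<lambda>N. norm ((g N - f N) / ln (real N)) \<le> C / ln (real N)) sequentially"
    using eventually_ge_at_top[of 2]
    by eventually_elim (use assms(2) in \<open>auto intro!: divide_right_mono\<close>)
  ultimately have "(\<lambda>N. (g N - f N) / ln (real N)) \<longlonglongrightarrow> 0"
    by (rule Lim_null_comparison[rotated])
  from tendsto_add[OF assms(1) this] show ?thesis by (simp add: diff_divide_distrib)
qed

lemma AE_near_half_unit:
  assumes c: "c > 0"
  shows "AE x in lborel. x \<in> {0..<1} \<longrightarrow>
           (\<lambda>N. real (card {n \<in> {1..N}. near_half c n x}) / ln (real N)) \<longlonglongrightarrow> c"
proof -
  \<comment> \<open>The added 1 makes \<open>2 * c < n0\<close> strict, so that windows of equal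
    denominator are disjoint. The finitely many \<open>n\<close> below \<open>n0\<close> change the
    count by a bounded amount, negligible against the logarithm.\<close>
  define n0 where "n0 = nat \<lceil>2 * c\<rceil> + 1"
  have n0: "n0 > 0" "2 * c < real n0" unfolding n0_def by linarith+
  show ?thesis
    using AE_hits_subsequence[OF c n0(1) less_imp_le[OF n0(2)]]
  proof eventually_elim
    case (elim x)
    show ?case
    proof
      assume x: "x \<in> {0..<1}"
      let ?f = "\<lambda>N. real (card {n \<in> {n0..N}. near_half c n x})"
      have "mono ?f" by (intro monoI of_nat_mono card_mono) auto
      then have "(\<lambda>N. ?f N / ln (real N)) \<longlonglongrightarrow> c * ln 2 / ln 2"
        using elim x by (intro tendsto_div_ln_of_subsequence) (simp_all add: hits_eq_card[OF c n0(2) x])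
      then have "(\<lambda>N. ?f N / ln (real N)) \<longlonglongrightarrow> c" by simp
      then show "(\<lambda>N. real (card {n \<in> {1..N}. near_half c n x}) / ln (real N)) \<longlonglongrightarrow> c"
      proof (rule tendsto_div_ln_bounded_change)
        fix N
        have "card {n \<in> {1..N}. near_half c n x} \<le> card ({n \<in> {n0..N}. near_half c n x} \<union> {1..n0})"
          by (intro card_mono) auto
        also have "\<dots> \<le> card {n \<in> {n0..N}. near_half c n x} + n0"
          by (rule order_trans[OF card_Un_le]) simp
        finally have "card {n \<in> {1..N}. near_half c n x} \<le> card {n \<in> {n0..N}. near_half c n x} + n0" .
        moreover have "card {n \<in> {n0..N}. near_half c n x} \<le> card {n \<in> {1..N}. near_half c n x}"
          using n0 by (intro card_mono) auto
        ultimately show "\<bar>real (card {n \<in> {1..N}. near_half c n x}) - ?f N\<bar> \<le> real n0" by linarith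
      qed
    qed
  qed
qed

lemma near_half_shift: "near_half c n (x - of_int z) \<longleftrightarrow> near_half c n x"
proof -
  have imp: "near_half c n (x + of_int z)" if "near_half c n x" for x :: real and z :: int
  proof -
    from that obtain k :: int where "0 < of_int k + 1/2 - real n * x" "of_int k + 1/2 - real n * x \<le> c / real n"
      by (auto simp: near_half_def)
    then show ?thesis unfolding near_half_def by (intro exI[of _ "k + int n * z"]) (simp add: algebra_simps)
  qed
  show ?thesis using imp[of x "- z"] imp[of "x - of_int z" z] by auto
qed

lemma AE_lborel_translate:
  assumes "AE x in lborel. P (x::real)"
  shows "AE x in lborel. P (x - a)"
proof -
  obtain N where N: "{x. \<not> P x} \<subseteq> N" "N \<in> null_sets lborel"
    using assms by (auto simp: eventually_ae_filter)
  have "{x. \<not> P (x - a)} \<subseteq> {x. x - a \<in> N}" using N by auto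
  with null_sets_translation[OF N(2), of a] show ?thesis
    by (auto simp: eventually_ae_filter)
qed

text \<open>Countably many integer translates of the exceptional null set are still null, so
  \<open>z\<close> may afterwards be chosen as the floor of \<open>x\<close>; the condition itself
  has period 1 in \<open>x\<close>.\<close>

lemma AE_near_half:
  assumes c: "c > 0"
  shows "AE x in lborel. (\<lambda>N. real (card {n \<in> {1..N}. near_half c n x}) / ln (real N)) \<longlonglongrightarrow> c"
proof -
  have "AE x in lborel. \<forall>z::int. x - of_int z \<in> {0..<1} \<longrightarrow>
      (\<lambda>N. real (card {n \<in> {1..N}. near_half c n (x - of_int z)}) / ln (real N)) \<longlonglongrightarrow> c"
    unfolding AE_all_countable by (intro allI AE_lborel_translate AE_near_half_unit c)
  then show ?thesis
  proof eventually_elim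
    case (elim x)
    have "x - of_int \<lfloor>x\<rfloor> \<in> {0..<1}" by (auto; linarith)
    with elim have "(\<lambda>N. real (card {n \<in> {1..N}. near_half c n (x - of_int \<lfloor>x\<rfloor>)}) / ln (real N)) \<longlonglongrightarrow> c" by blast
    then show ?case by (simp only: near_half_shift)
  qed
qed

section \<open>From the exceptional set to windows\<close>

text \<open>The source of the constant 1/12:
  \<open>1 / (exp t - 1) = 1 / t - 1/2 + t / 12 + o(t)\<close> as \<open>t\<close> tends to 0 from
  the right, taken at \<open>t = L / n\<close>.\<close>

lemma width_tendsto:
  fixes L :: real
  assumes L: "L > 0"
  shows "(\<lambda>n. real n * (1 / (exp (L / real n) - 1) - (real n / L - 1/2))) \<longlonglongrightarrow> L / 12"
proof -
  have "((\<lambda>t::real. (1 / (exp t - 1) - 1 / t + 1/2) / t) \<longlongrightarrow> 1 / 12) (at_right 0)"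
    by real_asymp
  moreover have "filterlim (\<lambda>n. L / real n) (at_right 0) sequentially"
    using L by real_asymp
  ultimately have "(\<lambda>n. L * ((1 / (exp (L / real n) - 1) - 1 / (L / real n) + 1/2) / (L / real n))) \<longlonglongrightarrow> L * (1 / 12)"
    by (intro tendsto_mult tendsto_const) (rule filterlim_compose)
  moreover have "L * ((1 / (exp (L / real n) - 1) - 1 / (L / real n) + 1/2) / (L / real n))
      = real n * (1 / (exp (L / real n) - 1) - (real n / L - 1/2))" for n
    using L by simp
  ultimately show ?thesis by simp
qed

text \<open>The inverse map \<open>exp (1 / x)\<close> is differentiable on the positive reals and
  therefore sends null sets to negligible sets. The detour through \<open>lebesgue\<close> is made
  because such an image need not be Borel.\<close>

lemma AE_reciprocal_ln:
  assumes "AE x in lborel. P (x :: real)"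
  shows "AE \<theta> in lborel. \<theta> > 1 \<longrightarrow> P (1 / ln \<theta>)"
proof -
  obtain N where N: "{x. \<not> P x} \<subseteq> N" "N \<in> null_sets lborel"
    using assms by (auto simp: eventually_ae_filter)
  define E where "E = (\<lambda>x::real. exp (1 / x)) ` (N \<inter> {0<..})"
  have "N \<in> null_sets lebesgue" using N(2) by (rule null_sets_completionI)
  then have "negligible (N \<inter> {0<..})"
    by (intro negligible_Int) (simp add: negligible_iff_null_sets)
  moreover have "(\<lambda>x::real. exp (1 / x)) differentiable_on (N \<inter> {0<..})"
    unfolding differentiable_on_def real_differentiable_def
  proof
    fix x :: real assume "x \<in> N \<inter> {0<..}"
    then have "((\<lambda>x. exp (1 / x)) has_real_derivative exp (1 / x) * (- 1 / (x * x))) (at x within N \<inter> {0<..})"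
      by (auto intro!: derivative_eq_intros)
    then show "\<exists>D. ((\<lambda>x. exp (1 / x)) has_real_derivative D) (at x within N \<inter> {0<..})" ..
  qed
  ultimately have "negligible E"
    unfolding E_def by (intro negligible_differentiable_image_negligible) auto
  then have "AE \<theta> in lebesgue. \<theta> \<notin> E"
    by (intro AE_not_in) (simp add: negligible_iff_null_sets)
  then have "AE \<theta> in lborel. \<theta> \<notin> E" by (simp add: AE_completion_iff)
  then show ?thesis
  proof eventually_elim
    case (elim \<theta>)
    show ?case
    proof
      assume \<theta>: "\<theta> > 1"
      have "\<theta> = exp (1 / (1 / ln \<theta>))" using \<theta> by simp
      moreover have "1 / ln \<theta> \<in> {0<..}" using \<theta> by simp
      ultimately have "1 / ln \<theta> \<notin> N" using elim unfolding E_def by blast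
      then show "P (1 / ln \<theta>)" using N(1) by blast
    qed
  qed
qed

lemma floor_add_neq_iff:
  fixes u w :: real
  assumes "w > 0"
  shows "\<lfloor>u + w\<rfloor> \<noteq> \<lfloor>u\<rfloor> \<longleftrightarrow> (\<exists>k::int. u < of_int k \<and> of_int k \<le> u + w)"
proof
  assume "\<lfloor>u + w\<rfloor> \<noteq> \<lfloor>u\<rfloor>"
  moreover have "\<lfloor>u\<rfloor> \<le> \<lfloor>u + w\<rfloor>" using assms by (intro floor_mono) simp
  ultimately have "u < of_int \<lfloor>u + w\<rfloor>" by linarith
  then show "\<exists>k::int. u < of_int k \<and> of_int k \<le> u + w" by (intro exI[of _ "\<lfloor>u + w\<rfloor>"]) simp
next
  assume "\<exists>k::int. u < of_int k \<and> of_int k \<le> u + w"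
  then obtain k :: int where "u < of_int k" "of_int k \<le> u + w" by blast
  then have "\<lfloor>u\<rfloor> < k" "k \<le> \<lfloor>u + w\<rfloor>" by (simp_all add: floor_less_iff le_floor_iff)
  then show "\<lfloor>u + w\<rfloor> \<noteq> \<lfloor>u\<rfloor>" by simp
qed

text \<open>The hypothesis is confined to rational constants so that it can hold for almost all
  arguments simultaneously; rationals on either side of \<open>L / 12\<close> suffice for the
  squeeze.\<close>

lemma A_set_tendsto:
  assumes \<theta>: "\<theta> > 1"
    and lim: "\<And>q::rat. q > 0 \<Longrightarrow>
      (\<lambda>N. real (card {n \<in> {1..N}. near_half (of_rat q) n (1 / ln \<theta>)}) / ln (real N)) \<longlonglongrightarrow> of_rat q"
  shows "(\<lambda>N. real (card (A_set \<theta> \<inter> {1..N})) / ln (real N)) \<longlonglongrightarrow> ln \<theta> / 12"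
proof -
  define L where "L = ln \<theta>"
  define w where "w = (\<lambda>n. 1 / (exp (L / real n) - 1) - (real n / L - 1/2))"
  define R where "R = (\<lambda>c N. {n \<in> {1..N}. near_half c n (1 / L)})"
  have L: "L > 0" using \<theta> by (simp add: L_def)
  have wlim: "(\<lambda>n. real n * w n) \<longlonglongrightarrow> L / 12"
    unfolding w_def by (rule width_tendsto[OF L])
  \<comment> \<open>The two floors differ exactly when an integer \<open>k\<close> lies above
    \<open>n / L - 1/2\<close> and at most \<open>w n\<close> beyond it. This is the condition of
    \<open>near_half\<close> with \<open>w n\<close> in place of \<open>c / n\<close>.\<close>
  have A_iff: "n \<in> A_set \<theta> \<longleftrightarrow>
      (\<exists>k::int. 0 < of_int k + 1/2 - real n * (1 / L) \<and> of_int k + 1/2 - real n * (1 / L) \<le> w n)"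
    if "n \<ge> 1" "w n > 0" for n
  proof -
    have "\<theta> powr (1 / real n) = exp (L / real n)" using \<theta> by (simp add: powr_def L_def)
    then have "1 / (\<theta> powr (1 / real n) - 1) = (real n / L - 1/2) + w n" by (simp add: w_def)
    then have "n \<in> A_set \<theta> \<longleftrightarrow> \<lfloor>(real n / L - 1/2) + w n\<rfloor> \<noteq> \<lfloor>real n / L - 1/2\<rfloor>"
      using that by (simp add: A_set_def Mprime_def L_def)
    also have "\<dots> \<longleftrightarrow> (\<exists>k::int. real n / L - 1/2 < of_int k \<and> of_int k \<le> (real n / L - 1/2) + w n)"
      by (rule floor_add_neq_iff[OF that(2)])
    finally show ?thesis by (simp add: algebra_simps)
  qed
  have bounded: "(\<lambda>N. (real (card (R c N)) + C) / ln (real N)) \<longlonglongrightarrow> c"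
    if "c = of_rat q" "q > 0" for c C :: real and q
    by (rule tendsto_div_ln_bounded_change[where C = "\<bar>C\<bar>", OF lim[OF that(2), folded that(1) L_def]]) (simp add: R_def)
  show ?thesis
    unfolding L_def[symmetric]
  proof (rule order_tendstoI)
    fix a assume "a < L / 12"
    \<comment> \<open>The maximum with 0 forces a positive rational, since \<open>lim\<close> speaks
      only of those.\<close>
    then have "max a 0 < L / 12" using L by simp
    then obtain q where q: "max a 0 < real_of_rat q" "of_rat q < L / 12" using of_rat_dense by blast
    define c where "c = real_of_rat q"
    have c: "c > 0" "q > 0" "a < c" using q by (auto simp: c_def)
    have "eventually (\<lambda>n. real n * w n > c) sequentially"
      using order_tendstoD(1)[OF wlim q(2)] by (simp add: c_def)
    then obtain n1 where n1: "\<And>n. n \<ge> n1 \<Longrightarrow> real n * w n > c"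
      by (auto simp: eventually_sequentially)
    have sub: "R c N \<subseteq> (A_set \<theta> \<inter> {1..N}) \<union> {..<n1}" for N
    proof
      fix n assume n: "n \<in> R c N"
      show "n \<in> (A_set \<theta> \<inter> {1..N}) \<union> {..<n1}"
      proof (cases "n < n1")
        case False
        have "n \<ge> 1" using n by (simp add: R_def)
        have "c / real n < w n" using n1[of n] False \<open>n \<ge> 1\<close> by (simp add: field_simps)
        moreover have "c / real n > 0" using c \<open>n \<ge> 1\<close> by simp
        ultimately have "n \<in> A_set \<theta>"
          using n by (subst A_iff[OF \<open>n \<ge> 1\<close>]) (force simp: R_def near_half_def)+
        then show ?thesis using n by (simp add: R_def)
      qed simp
    qed
    have card: "real (card (R c N)) + (- real n1) \<le> real (card (A_set \<theta> \<inter> {1..N}))" for N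
    proof -
      have "card (R c N) \<le> card ((A_set \<theta> \<inter> {1..N}) \<union> {..<n1})"
        by (rule card_mono[OF _ sub]) simp
      also have "\<dots> \<le> card (A_set \<theta> \<inter> {1..N}) + n1"
        by (rule order_trans[OF card_Un_le]) simp
      finally show ?thesis by simp
    qed
    show "eventually (\<lambda>N. a < real (card (A_set \<theta> \<inter> {1..N})) / ln (real N)) sequentially"
      using order_tendstoD(1)[OF bounded[OF c_def c(2), of "- real n1"] c(3)] eventually_ge_at_top[of 2]
    proof eventually_elim
      case (elim N)
      have "(real (card (R c N)) + (- real n1)) / ln (real N) \<le> real (card (A_set \<theta> \<inter> {1..N})) / ln (real N)"
        using elim by (intro divide_right_mono card) auto
      with elim show ?case by linarith
    qed
  next
    fix a assume "L / 12 < a"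
    then obtain q where q: "L / 12 < real_of_rat q" "of_rat q < a" using of_rat_dense by blast
    define c where "c = real_of_rat q"
    have "real_of_rat q > 0" using q(1) L by linarith
    then have c: "q > 0" "c < a" using q by (simp_all add: c_def)
    have "eventually (\<lambda>n. real n * w n < c \<and> real n * w n > 0) sequentially"
      using order_tendstoD(2)[OF wlim q(1)] order_tendstoD(1)[OF wlim, of 0] L
      by (auto simp: c_def intro: eventually_conj)
    then obtain n1 where n1: "\<And>n. n \<ge> n1 \<Longrightarrow> real n * w n < c \<and> real n * w n > 0"
      by (auto simp: eventually_sequentially)
    have sub: "A_set \<theta> \<inter> {1..N} \<subseteq> R c N \<union> {..<n1}" for N
    proof
      fix n assume n: "n \<in> A_set \<theta> \<inter> {1..N}"
      show "n \<in> R c N \<union> {..<n1}"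
      proof (cases "n < n1")
        case False
        have "n \<ge> 1" using n by simp
        have "w n < c / real n" "w n > 0"
          using n1[of n] False \<open>n \<ge> 1\<close> by (simp_all add: field_simps zero_less_mult_iff)
        then have "near_half c n (1 / L)"
          using n A_iff[OF \<open>n \<ge> 1\<close> \<open>w n > 0\<close>] unfolding near_half_def by force
        then show ?thesis using n by (simp add: R_def)
      qed simp
    qed
    have card: "real (card (A_set \<theta> \<inter> {1..N})) \<le> real (card (R c N)) + real n1" for N
    proof -
      have "card (A_set \<theta> \<inter> {1..N}) \<le> card (R c N \<union> {..<n1})"
        by (rule card_mono[OF _ sub]) (simp add: R_def)
      also have "\<dots> \<le> card (R c N) + n1"
        by (rule order_trans[OF card_Un_le]) simp
      finally show ?thesis by simp
    qed
    show "eventually (\<lambda>N. real (card (A_set \<theta> \<inter> {1..N})) / ln (real N) < a) sequentially"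
      using order_tendstoD(2)[OF bounded[OF c_def c(1), of "real n1"] c(2)] eventually_ge_at_top[of 2]
    proof eventually_elim
      case (elim N)
      have "real (card (A_set \<theta> \<inter> {1..N})) / ln (real N) \<le> (real (card (R c N)) + real n1) / ln (real N)"
        using elim by (intro divide_right_mono card) auto
      with elim show ?case by linarith
    qed
  qed
qed

theorem theorem4:
  shows "AE \<theta> in lborel. \<theta> > 1 \<longrightarrow>
    (\<lambda>n::nat. real (card (A_set \<theta> \<inter> {1..n}))) \<sim>[at_top] (\<lambda>n. ln \<theta> / 12 * ln (real n))"
proof -
  \<comment> \<open>Countability of the rationals moves the quantifier over \<open>q\<close> inside,
    giving a single null set, which is then carried over to \<open>\<theta>\<close> by
    \<open>x = 1 / ln \<theta>\<close>.\<close>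
  have "AE x in lborel. \<forall>q::rat. q > 0 \<longrightarrow>
      (\<lambda>N. real (card {n \<in> {1..N}. near_half (of_rat q) n x}) / ln (real N)) \<longlonglongrightarrow> of_rat q"
    unfolding AE_all_countable by (intro allI AE_impI AE_near_half) simp
  from AE_reciprocal_ln[OF this] show ?thesis
  proof eventually_elim
    case (elim \<theta>)
    show ?case
    proof
      assume \<theta>: "\<theta> > 1"
      then have "(\<lambda>N. real (card (A_set \<theta> \<inter> {1..N})) / ln (real N)) \<longlonglongrightarrow> ln \<theta> / 12"
        using elim by (intro A_set_tendsto) auto
      then show "(\<lambda>n::nat. real (card (A_set \<theta> \<inter> {1..n}))) \<sim>[at_top] (\<lambda>n. ln \<theta> / 12 * ln (real n))"
        using \<theta> by (intro asymp_equivI'_const) simp_all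
    qed
  qed
qed

end
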